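(* Let $\Delta$ be a pure shellable simplicial complex on the vertex set $X=\{x_1,\ldots,x_n\}$, let $K$ be a field, $S=K[x_1,\ldots,x_n]$, and let $k>0$ be an integer. Then the expansion $K[\Delta]^{\mathbf{k}}=S^{\mathbf{k}}/(I_\Delta)^{\mathbf{k}}$ of the face ring $K[\Delta]=S/I_\Delta$ with respect to $k$ satisfies the Stanley conjecture, i.e. $\operatorname{sdepth}(K[\Delta]^{\mathbf{k}})\geq \operatorname{depth}(K[\Delta]^{\mathbf{k}})$. In particular, the face ring of a pure $k$-shellable simplicial complex satisfies the Stanley conjecture.
   Context: For a simplicial complex $\Delta$ on $X$, $I_\Delta\subset S$ is the Stanley–Reisner ideal (generated by the squarefree monomials $\prod_{x\in F}x$ with $F\notin\Delta$) and $K[\Delta]=S/I_\Delta$ is the face ring. For faces $F_1,\dots,F_s$, $\langle F_1,\ldots,F_s\rangle$ denotes the simplicial complex whose facets are $F_1,\dots,F_s$. $\Delta$ is shellable if its facets can be ordered $F_1,\ldots,F_r$ so that for all $j\geq 2$, $\langle F_j\rangle\cap\langle F_1,\ldots,F_{j-1}\rangle$ is pure of dimension $\dim F_j-1$. Expansion: $S^{\mathbf{k}}$ is the polynomial ring over $K$ in variables $x_{ij}$, $1\le i\le n$, $1\le j\le k$; $P_i=(x_{i1},\ldots,x_{ik})\subset S^{\mathbf{k}}$. For a monomial ideal $I\subset S$ minimally generated by $u_1,\ldots,u_r$, $I^{\mathbf{k}}=\sum_{i=1}^r P_1^{\nu_1(u_i)}\cdots P_n^{\nu_n(u_i)}$,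 where $\nu_j(u)$ is the exponent of $x_j$ in $u$; and $(S/I)^{\mathbf{k}}=S^{\mathbf{k}}/I^{\mathbf{k}}$. A $k$-shellable complex: let $\Delta$ have dimension $d$ and $1\le k\le d+1$; $\Delta$ is $k$-shellable if its facets can be ordered $F_1,\ldots,F_r$ such that for every $j=2,\ldots,r$, the complex $\Delta_j=\langle F_j\rangle\cap\langle F_1,\ldots,F_{j-1}\rangle$ satisfies (i) $\Delta_j$ is generated by a nonempty set of faces of $\langle F_j\rangle$ of dimension $|F_j|-k-1$; (ii) if $\Delta_j$ has more than one facet, then for every two distinct facets $\sigma,\tau$ of $\Delta_j$ we have $F_j\subseteq\sigma\cup\tau$. Stanley depth: for a finitely generated $\mathbb{Z}^n$-graded module $M$ over a polynomial ring, a Stanley space is $uK[Z]$ with $u\in M$ homogeneous and $Z$ a subset of the variables such that $uK[Z]$ is a free $K[Z]$-module of rank 1; a Stanley decomposition is a finite direct sum decomposition of $M$ (as a $K$-vector space) into Stanley spaces; its Stanley depth is the minimal $|Z|$ occurring; $\operatorname{sdepth}(M)$ is the maximum of this over all Stanley decompositions. The Stanley conjecture for $M$ is the inequality $\operatorname{sdepth}(M)\ge\operatorname{depth}(M)$. *)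

theory Defs
  imports Main "HOL-Library.Poly_Mapping" "HOL-Library.Extended_Nat"
begin

text \<open>Polynomials in variables of type 'w with coefficients in 'k are represented as
  finitely supported maps from monomials (finitely supported exponent vectors) to coefficients.
  The polynomial ring K[V] in a set V of variables is the set of polynomials
  all of whose monomials only involve variables from V.\<close>

type_synonym ('w, 'k) mpoly = "('w \<Rightarrow>\<^sub>0 nat) \<Rightarrow>\<^sub>0 'k"

definition polys :: "'w set \<Rightarrow> ('w, 'k::field) mpoly set" where
  "polys V = {p :: ('w, 'k) mpoly. \<forall>m \<in> Poly_Mapping.keys p. Poly_Mapping.keys m \<subseteq> V}"

definition var :: "'w \<Rightarrow> ('w, 'k::field) mpoly" where
  "var x = Poly_Mapping.single (Poly_Mapping.single x 1) 1"

definition monom :: "('w \<Rightarrow>\<^sub>0 nat) \<Rightarrow> ('w, 'k::field) mpoly" where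
  "monom m = Poly_Mapping.single m 1"

definition gen_ideal :: "('w, 'k::field) mpoly set \<Rightarrow> ('w, 'k) mpoly set \<Rightarrow> ('w, 'k) mpoly set" where
  "gen_ideal R G = {(\<Sum>g\<in>F. c g * g) | F c. finite F \<and> F \<subseteq> G \<and> (\<forall>g\<in>F. c g \<in> R)}"

definition ideal_mult :: "('w, 'k::field) mpoly set \<Rightarrow> ('w, 'k) mpoly set \<Rightarrow> ('w, 'k) mpoly set \<Rightarrow> ('w, 'k) mpoly set" where
  "ideal_mult R I J = gen_ideal R {a * b | a b. a \<in> I \<and> b \<in> J}"

definition ideal_power :: "('w, 'k::field) mpoly set \<Rightarrow> ('w, 'k) mpoly set \<Rightarrow> nat \<Rightarrow> ('w, 'k) mpoly set" where
  "ideal_power R I n = (ideal_mult R I ^^ n) R"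

definition ideal_prod :: "('w, 'k::field) mpoly set \<Rightarrow> ('a \<Rightarrow> ('w, 'k) mpoly set) \<Rightarrow> 'a set \<Rightarrow> ('w, 'k) mpoly set" where
  "ideal_prod R Is A = foldr (\<lambda>i J. ideal_mult R (Is i) J) (SOME xs. set xs = A \<and> distinct xs) R"

definition mon_divides :: "('w \<Rightarrow>\<^sub>0 nat) \<Rightarrow> ('w \<Rightarrow>\<^sub>0 nat) \<Rightarrow> bool" where
  "mon_divides m m' \<longleftrightarrow> (\<forall>x. Poly_Mapping.lookup m x \<le> Poly_Mapping.lookup m' x)"

definition mingens :: "('w, 'k::field) mpoly set \<Rightarrow> ('w \<Rightarrow>\<^sub>0 nat) set" where
  "mingens I = {u. monom u \<in> I \<and> (\<forall>v. monom v \<in> I \<and> mon_divides v u \<longrightarrow> v = u)}"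

text \<open>Variables x_{ij}, 1 \<le> i \<le> n (i.e. x_i \<in> X), 1 \<le> j \<le> k, of S^k.\<close>
definition exp_vars :: "'v set \<Rightarrow> nat \<Rightarrow> ('v \<times> nat) set" where
  "exp_vars X k = X \<times> {1..k}"

definition P_ideal :: "'v set \<Rightarrow> nat \<Rightarrow> 'v \<Rightarrow> ('v \<times> nat, 'k::field) mpoly set" where
  "P_ideal X k i = gen_ideal (polys (exp_vars X k)) {var (i, j) | j. 1 \<le> j \<and> j \<le> k}"

text \<open>I^k = \<Sum>_{u \<in> G(I)} P_1^{\<nu>_1(u)} \<cdots> P_n^{\<nu>_n(u)}; a sum of ideals is the ideal
  generated by their union.\<close>
definition expansion :: "'v set \<Rightarrow> nat \<Rightarrow> ('v, 'k::field) mpoly set \<Rightarrow> ('v \<times> nat, 'k) mpoly set" where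
  "expansion X k I = (let R = polys (exp_vars X k) in
     gen_ideal R (\<Union>u \<in> mingens I.
        ideal_prod R (\<lambda>i. ideal_power R (P_ideal X k i) (Poly_Mapping.lookup u i)) X))"

definition simplicial_complex :: "'v set \<Rightarrow> 'v set set \<Rightarrow> bool" where
  "simplicial_complex X \<Delta> \<longleftrightarrow> \<Delta> \<subseteq> Pow X \<and> {} \<in> \<Delta> \<and> (\<forall>x\<in>X. {x} \<in> \<Delta>)
     \<and> (\<forall>F\<in>\<Delta>. \<forall>G. G \<subseteq> F \<longrightarrow> G \<in> \<Delta>)"

definition facets :: "'v set set \<Rightarrow> 'v set set" where
  "facets \<Delta> = {F \<in> \<Delta>. \<forall>G \<in> \<Delta>. F \<subseteq> G \<longrightarrow> G = F}"

definition dimf :: "'v set \<Rightarrow> int" where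
  "dimf F = int (card F) - 1"

definition dimc :: "'v set set \<Rightarrow> int" where
  "dimc \<Delta> = Max (dimf ` \<Delta>)"

definition pure :: "'v set set \<Rightarrow> bool" where
  "pure \<Delta> \<longleftrightarrow> (\<forall>F \<in> facets \<Delta>. dimf F = dimc \<Delta>)"

definition gen_complex :: "'v set set \<Rightarrow> 'v set set" where
  "gen_complex Fs = {G. \<exists>F \<in> Fs. G \<subseteq> F}"

definition shelling_order :: "'v set set \<Rightarrow> 'v set list \<Rightarrow> bool" where
  "shelling_order \<Delta> Fs \<longleftrightarrow> distinct Fs \<and> set Fs = facets \<Delta>"

definition shellable :: "'v set set \<Rightarrow> bool" where
  "shellable \<Delta> \<longleftrightarrow> (\<exists>Fs. shelling_order \<Delta> Fs \<and>
     (\<forall>j. 1 \<le> j \<and> j < length Fs \<longrightarrow>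
        (let \<Gamma> = gen_complex {Fs ! j} \<inter> gen_complex (set (take j Fs))
         in pure \<Gamma> \<and> dimc \<Gamma> = dimf (Fs ! j) - 1)))"

definition k_shellable :: "nat \<Rightarrow> 'v set set \<Rightarrow> bool" where
  "k_shellable k \<Delta> \<longleftrightarrow> 1 \<le> int k \<and> int k \<le> dimc \<Delta> + 1 \<and>
    (\<exists>Fs. shelling_order \<Delta> Fs \<and>
     (\<forall>j. 1 \<le> j \<and> j < length Fs \<longrightarrow>
        (let Fj = Fs ! j; \<Gamma> = gen_complex {Fj} \<inter> gen_complex (set (take j Fs))
         in (\<exists>A. A \<noteq> {} \<and> A \<subseteq> gen_complex {Fj}
                 \<and> (\<forall>G \<in> A. dimf G = int (card Fj) - int k - 1) \<and> \<Gamma> = gen_complex A)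
          \<and> (card (facets \<Gamma>) > 1 \<longrightarrow>
               (\<forall>\<sigma> \<in> facets \<Gamma>. \<forall>\<tau> \<in> facets \<Gamma>. \<sigma> \<noteq> \<tau> \<longrightarrow> Fj \<subseteq> \<sigma> \<union> \<tau>)))))"

definition SR_ideal :: "'v set \<Rightarrow> 'v set set \<Rightarrow> ('v, 'k::field) mpoly set" where
  "SR_ideal X \<Delta> = gen_ideal (polys X) {(\<Prod>x\<in>F. var x) | F. F \<subseteq> X \<and> F \<notin> \<Delta>}"

text \<open>A Stanley space u K[Z] of M = K[V]/J: u is (a representative of) a homogeneous
  element, i.e. a term c x^a, Z \<subseteq> V, and u K[Z] is free of rank 1 over K[Z].
  A Stanley decomposition is a finite family D of such (u,Z) such that M is the
  direct sum (as K-vector space) of the images of u K[Z].\<close>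
definition stanley_decomposition ::
  "'w set \<Rightarrow> ('w, 'k::field) mpoly set \<Rightarrow> (('w, 'k) mpoly \<times> 'w set) set \<Rightarrow> bool" where
  "stanley_decomposition V J D \<longleftrightarrow> finite D \<and>
     (\<forall>(u, Z) \<in> D. u \<in> polys V \<and> (\<exists>c m. u = Poly_Mapping.single m c) \<and> Z \<subseteq> V \<and>
        (\<forall>f \<in> polys Z. u * f \<in> J \<longrightarrow> f = 0)) \<and>
     (\<forall>p \<in> polys V. \<exists>f. (\<forall>d \<in> D. f d \<in> polys (snd d)) \<and> p - (\<Sum>d\<in>D. fst d * f d) \<in> J) \<and>
     (\<forall>f. (\<forall>d \<in> D. f d \<in> polys (snd d)) \<and> (\<Sum>d\<in>D. fst d * f d) \<in> J \<longrightarrow>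
          (\<forall>d \<in> D. fst d * f d \<in> J))"

definition sdepth :: "'w set \<Rightarrow> ('w, 'k::field) mpoly set \<Rightarrow> enat" where
  "sdepth V J = (SUP D \<in> {D. stanley_decomposition V J D}. INF d \<in> D. enat (card (snd d)))"

text \<open>M-regular sequences (M = K[V]/J) in the graded maximal ideal m = (V).\<close>
definition regular_seq :: "'w set \<Rightarrow> ('w, 'k::field) mpoly set \<Rightarrow> ('w, 'k) mpoly list \<Rightarrow> bool" where
  "regular_seq V J fs \<longleftrightarrow>
     set fs \<subseteq> gen_ideal (polys V) (var ` V) \<and>
     (\<forall>i < length fs. \<forall>g \<in> polys V.
        fs ! i * g \<in> gen_ideal (polys V) (J \<union> set (take i fs)) \<longrightarrow>
        g \<in> gen_ideal (polys V) (J \<union> set (take i fs))) \<and>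
     gen_ideal (polys V) (J \<union> set fs) \<noteq> polys V"

definition depth :: "'w set \<Rightarrow> ('w, 'k::field) mpoly set \<Rightarrow> enat" where
  "depth V J = (SUP fs \<in> {fs. regular_seq V J fs}. enat (length fs))"

definition stanley_conjecture_holds :: "'w set \<Rightarrow> ('w, 'k::field) mpoly set \<Rightarrow> bool" where
  "stanley_conjecture_holds V J \<longleftrightarrow> sdepth V J \<ge> depth V J"

end

theory Submission
  imports Defs
begin

text \<open>Both rings in question are face rings of complexes \<open>\<Delta>\<close> whose facets \<open>F\<^sub>1, \<dots>, F\<^sub>r\<close> can be
  ordered so that a face of \<open>F\<^sub>j\<close> lies in an earlier facet iff it misses one of \<open>p\<^sub>j\<close> pairwise disjoint
  \<open>k\<close>-element blocks of \<open>F\<^sub>j\<close>. Write \<open>s\<^sub>j = (d - k p\<^sub>j) + p\<^sub>j\<close> with \<open>d = card F\<^sub>j\<close>.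

  Splitting the maximal ideal of the polynomial ring of each block by least variable decomposes
  \<open>\<Delta>\<close> into intervals whose tops have at least \<open>s\<^sub>j\<close> elements, so \<open>sdepth \<ge> min\<^sub>j s\<^sub>j\<close>.
  Conversely, let \<open>G\<close> be \<open>F\<^sub>j\<close> without its blocks. By Mayer-Vietoris along the ordering, the
  link of \<open>G\<close> has nonzero reduced cohomology in dimension \<open>p\<^sub>j - 1\<close>. Such a class gives a nonzero Koszul
  cohomology class of the face ring in degree \<open>card G + p\<^sub>j = s\<^sub>j\<close>, whence \<open>depth \<le> s\<^sub>j\<close>.

  All complexes of cochains use functions on arbitrary lists of vertices instead of alternating
  functions: no orientation is needed and the differential is recursive on the list.\<close>

section \<open>Cochains on lists and acyclicity\<close>

text \<open>In the expansion a facet \<open>F\<close> becomes \<open>F \<times> {1..k}\<close> and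
  each vertex its fibre of \<open>k\<close> variables. A pure shelling has single vertices as
  blocks, so its expansion has blocks of size \<open>k\<close>, exactly as a
  \<open>k\<close>-shelling has; this is why one argument serves both halves. The depth itself is
  never computed: the two bounds meet at a facet with least \<open>s_j\<close>.

  The obstacle is the upper bound on the depth: it must hold for every regular sequence, homogeneous
  or not, and a class in the link of \<open>G\<close> must be moved up to a Koszul class. One
  operator serves on both sides. \<open>kd y\<close> is the exterior product with the one-form
  \<open>y\<close>: at \<open>vs\<close> it is the alternating sum of \<open>y v\<close> times the
  value of \<open>z\<close> at \<open>vs\<close> with one entry \<open>v\<close> deleted. With
  \<open>y\<close> constantly 1 this is the augmented simplicial coboundary, with powers of
  variables it is the Koszul differential. Cochains are total functions and a complex only selects
  the lists on which an equation is tested, so restriction costs nothing and extension is by any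
  formula.\<close>

primrec kd :: "('w \<Rightarrow> 'a::comm_ring_1) \<Rightarrow> ('w list \<Rightarrow> 'a) \<Rightarrow> 'w list \<Rightarrow> 'a" where
  "kd y z [] = 0"
| "kd y z (v # vs) = y v * z vs - kd y (\<lambda>ws. z (v # ws)) vs"
  for y

lemma kd_cong:
  assumes "\<And>v. v \<in> set vs \<Longrightarrow> y v = y' v"
    and "\<And>ws. set ws \<subseteq> set vs \<Longrightarrow> Suc (length ws) = length vs \<Longrightarrow> z ws = z' ws"
  shows "kd y z vs = kd y' z' vs"
  using assms
proof (induction vs arbitrary: z z')
  case (Cons v vs)
  have "kd y (\<lambda>ws. z (v # ws)) vs = kd y' (\<lambda>ws. z' (v # ws)) vs"
    by (rule Cons.IH) (auto intro!: Cons.prems)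
  moreover have "z vs = z' vs"
    by (rule Cons.prems) auto
  ultimately show ?case
    using Cons.prems(1) by simp
qed simp

lemma kd_zero [simp]: "kd y (\<lambda>_. 0) vs = 0"
  by (induction vs) auto

lemma kd_add: "kd y (\<lambda>ws. z ws + z' ws) vs = kd y z vs + kd y z' vs"
  by (induction vs arbitrary: z z') (auto simp: algebra_simps)

lemma kd_scale: "kd y (\<lambda>ws. c * z ws) vs = c * kd y z vs"
  by (induction vs arbitrary: z) (auto simp: algebra_simps)

lemma kd_uminus: "kd y (\<lambda>ws. - z ws) vs = - kd y z vs"
  using kd_scale[of y "-1" z vs] by simp

lemma kd_diff: "kd y (\<lambda>ws. z ws - z' ws) vs = kd y z vs - kd y z' vs"
  using kd_add[of y z "\<lambda>ws. - z' ws"] by (simp add: kd_uminus)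

lemma kd_form_zero: "(\<And>v. v \<in> set vs \<Longrightarrow> y v = 0) \<Longrightarrow> kd y z vs = 0"
  by (induction vs arbitrary: z) auto

lemma kd_form_add: "kd (\<lambda>v. y v + y' v) z vs = kd y z vs + kd y' z vs"
  by (induction vs arbitrary: z) (auto simp: algebra_simps)

lemma kd_form_scale: "kd (\<lambda>v. c * y v) z vs = c * kd y z vs"
  by (induction vs arbitrary: z) (auto simp: algebra_simps)

lemma kd_form_sum: "kd (\<lambda>v. \<Sum>i\<in>A. y i v) z vs = (\<Sum>i\<in>A. kd (y i) z vs)"
proof (induction A rule: infinite_finite_induct)
  case (insert i A)
  then show ?case
    using kd_form_add[of "y i" "\<lambda>v. \<Sum>i\<in>A. y i v"] by simp
qed (auto intro: kd_form_zero)

lemma kd_anticommute: "kd a (kd b z) vs = - kd b (kd a z) vs"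
proof (induction vs arbitrary: z)
  case (Cons v vs)
  have "kd c (\<lambda>ws. kd e z (v # ws)) vs
      = e v * kd c z vs - kd c (kd e (\<lambda>ws. z (v # ws))) vs" for c e
    using kd_diff[of c "\<lambda>ws. e v * z ws" "kd e (\<lambda>ws. z (v # ws))" vs]
      kd_scale[of c "e v" z vs] by simp
  then show ?case
    using Cons.IH[of "\<lambda>ws. z (v # ws)"] by (simp only: kd.simps) (simp add: algebra_simps)
qed simp

text \<open>Anticommutation with \<open>a = b\<close> gives only that twice the value is 0, which is
  void in characteristic 2; hence a separate induction.\<close>

lemma kd_kd: "kd a (kd a z) vs = 0"
proof (induction vs arbitrary: z)
  case (Cons v vs)
  have "kd a (\<lambda>ws. kd a z (v # ws)) vs
      = a v * kd a z vs - kd a (kd a (\<lambda>ws. z (v # ws))) vs"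
    using kd_diff[of a "\<lambda>ws. a v * z ws" "kd a (\<lambda>ws. z (v # ws))" vs]
      kd_scale[of a "a v" z vs] by simp
  then show ?case
    using Cons.IH[of "\<lambda>ws. z (v # ws)"] by (simp only: kd.simps) (simp add: algebra_simps)
qed simp

lemma kd_closed:
  assumes "\<And>p q. p \<in> I \<Longrightarrow> q \<in> I \<Longrightarrow> p - q \<in> I" "0 \<in> I"
    and "\<And>v p. v \<in> set vs \<Longrightarrow> p \<in> I \<Longrightarrow> y v * p \<in> I"
    and "\<And>ws. set ws \<subseteq> set vs \<Longrightarrow> Suc (length ws) = length vs \<Longrightarrow> z ws \<in> I"
  shows "kd y z vs \<in> I"
  using assms(3,4)
proof (induction vs arbitrary: z)
  case (Cons v vs)
  have "kd y (\<lambda>ws. z (v # ws)) vs \<in> I"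
    by (rule Cons.IH) (auto intro!: Cons.prems)
  moreover have "z vs \<in> I"
    by (rule Cons.prems) auto
  ultimately show ?case
    using Cons.prems(1) assms(1) by simp
qed (simp add: assms(2))

section \<open>Reduced cohomology and Mayer-Vietoris\<close>

definition subset_closed :: "'w set set \<Rightarrow> bool" where
  "subset_closed \<Gamma> \<longleftrightarrow> (\<forall>A\<in>\<Gamma>. \<forall>B\<subseteq>A. B \<in> \<Gamma>)"

text \<open>Vanishing of the reduced simplicial cohomology in dimension \<open>m - 1\<close>, computed from
  cochains on arbitrary vertex lists (repetitions allowed).\<close>
definition acyclic_at :: "'k::field itself \<Rightarrow> 'w set set \<Rightarrow> nat \<Rightarrow> bool" where
  "acyclic_at _ \<Gamma> m \<longleftrightarrow> (\<forall>u :: 'w list \<Rightarrow> 'k.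
     (\<forall>vs. length vs = Suc m \<longrightarrow> set vs \<in> \<Gamma> \<longrightarrow> kd (\<lambda>_. 1) u vs = 0) \<longrightarrow>
     (\<exists>w. \<forall>vs. length vs = m \<longrightarrow> set vs \<in> \<Gamma> \<longrightarrow> u vs = kd (\<lambda>_. 1) w vs))"

lemma acyclic_atE:
  fixes u :: "'w list \<Rightarrow> 'k::field"
  assumes "acyclic_at (T :: 'k::field itself) \<Gamma> m"
    and "\<And>vs. length vs = Suc m \<Longrightarrow> set vs \<in> \<Gamma> \<Longrightarrow> kd (\<lambda>_. 1) u vs = 0"
  obtains w where "\<And>vs. length vs = m \<Longrightarrow> set vs \<in> \<Gamma> \<Longrightarrow> u vs = kd (\<lambda>_. 1) w vs"
proof -
  have "\<exists>w. \<forall>vs. length vs = m \<longrightarrow> set vs \<in> \<Gamma> \<longrightarrow> u vs = kd (\<lambda>_. 1) w vs"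
    using assms(1)[unfolded acyclic_at_def, rule_format, of u] assms(2) by blast
  then show thesis using that by blast
qed

lemma not_acyclic_atE:
  assumes "\<not> acyclic_at (T :: 'k::field itself) \<Gamma> m"
  obtains u :: "'w list \<Rightarrow> 'k::field"
  where "\<And>vs. length vs = Suc m \<Longrightarrow> set vs \<in> \<Gamma> \<Longrightarrow> kd (\<lambda>_. 1) u vs = 0"
    and "\<And>w. \<exists>vs. length vs = m \<and> set vs \<in> \<Gamma> \<and> u vs \<noteq> kd (\<lambda>_. 1) w vs"
proof -
  have "\<exists>u :: 'w list \<Rightarrow> 'k.
     (\<forall>vs. length vs = Suc m \<longrightarrow> set vs \<in> \<Gamma> \<longrightarrow> kd (\<lambda>_. 1) u vs = 0) \<and>
     \<not> (\<exists>w. \<forall>vs. length vs = m \<longrightarrow> set vs \<in> \<Gamma> \<longrightarrow> u vs = kd (\<lambda>_. 1) w vs)"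
    using assms unfolding acyclic_at_def by (simp only: not_all not_imp)
  then obtain u :: "'w list \<Rightarrow> 'k" where
     1: "\<forall>vs. length vs = Suc m \<longrightarrow> set vs \<in> \<Gamma> \<longrightarrow> kd (\<lambda>_. 1) u vs = 0" and
     2: "\<not> (\<exists>w. \<forall>vs. length vs = m \<longrightarrow> set vs \<in> \<Gamma> \<longrightarrow> u vs = kd (\<lambda>_. 1) w vs)"
    by (elim exE conjE)
  from 2 have "\<exists>vs. length vs = m \<and> set vs \<in> \<Gamma> \<and> u vs \<noteq> kd (\<lambda>_. 1) w vs" for w
    by (simp only: not_ex not_all not_imp)
  with 1 show thesis using that by blast
qed

lemma kd_cong_in:
  assumes "subset_closed \<Gamma>" "set vs \<in> \<Gamma>" "length vs = Suc m"
    and "\<And>ws. set ws \<in> \<Gamma> \<Longrightarrow> length ws = m \<Longrightarrow> z ws = z' ws"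
  shows "kd y z vs = kd y z' vs"
  using assms by (intro kd_cong) (auto simp: subset_closed_def)

lemma acyclic_at_empty [simp]: "acyclic_at T {} m"
  by (simp add: acyclic_at_def)

text \<open>Prefixing \<open>p\<close> is a contracting homotopy. As lists may repeat entries,
  \<open>p # vs\<close> is admissible even if \<open>p\<close> already occurs in
  \<open>vs\<close>.\<close>

lemma acyclic_at_cone:
  assumes "\<And>A. A \<in> \<Gamma> \<Longrightarrow> insert p A \<in> \<Gamma>"
  shows "acyclic_at (T :: 'k::field itself) \<Gamma> m"
  unfolding acyclic_at_def
proof (intro allI impI)
  fix u :: "'a list \<Rightarrow> 'k"
  assume u: "\<forall>vs. length vs = Suc m \<longrightarrow> set vs \<in> \<Gamma> \<longrightarrow> kd (\<lambda>_. 1) u vs = 0"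
  show "\<exists>w. \<forall>vs. length vs = m \<longrightarrow> set vs \<in> \<Gamma> \<longrightarrow> u vs = kd (\<lambda>_. 1) w vs"
  proof (intro exI[of _ "\<lambda>ws. u (p # ws)"] allI impI)
    fix vs assume "length vs = m" "set vs \<in> \<Gamma>"
    then have "kd (\<lambda>_. 1) u (p # vs) = 0"
      using u[rule_format, of "p # vs"] assms by simp
    then show "u vs = kd (\<lambda>_. 1) (\<lambda>ws. u (p # ws)) vs"
      by simp
  qed
qed

lemma acyclic_at_Pow: "E \<noteq> {} \<Longrightarrow> acyclic_at T (Pow E) m"
  by (metis Pow_iff acyclic_at_cone all_not_in_conv insert_subset)

text \<open>Local primitives \<open>w1\<close> and \<open>w2\<close> differ on the intersection by a
  cocycle one degree lower; its primitive \<open>q\<close> corrects \<open>w2\<close> so that the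
  two glue. In degree 0 only the empty list is tested, where all coboundaries vanish, so the
  intersection is consulted only for \<open>m = Suc m'\<close>.\<close>

lemma acyclic_at_Un:
  fixes T :: "'k::field itself"
  assumes cl: "subset_closed \<Gamma>1" "subset_closed \<Gamma>2"
    and ac: "acyclic_at T \<Gamma>1 m" "acyclic_at T \<Gamma>2 m"
    and int: "\<And>m'. m = Suc m' \<Longrightarrow> acyclic_at T (\<Gamma>1 \<inter> \<Gamma>2) m'"
  shows "acyclic_at T (\<Gamma>1 \<union> \<Gamma>2) m"
  unfolding acyclic_at_def
proof (intro allI impI)
  let ?d = "kd (\<lambda>_. 1 :: 'k)"
  fix u :: "'a list \<Rightarrow> 'k"
  assume u: "\<forall>vs. length vs = Suc m \<longrightarrow> set vs \<in> \<Gamma>1 \<union> \<Gamma>2 \<longrightarrow> ?d u vs = 0"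
  obtain w1 where w1: "\<And>vs. length vs = m \<Longrightarrow> set vs \<in> \<Gamma>1 \<Longrightarrow> u vs = ?d w1 vs"
    by (rule acyclic_atE[OF ac(1), of u]) (use u in auto)
  obtain w2 where w2: "\<And>vs. length vs = m \<Longrightarrow> set vs \<in> \<Gamma>2 \<Longrightarrow> u vs = ?d w2 vs"
    by (rule acyclic_atE[OF ac(2), of u]) (use u in auto)
  show "\<exists>w. \<forall>vs. length vs = m \<longrightarrow> set vs \<in> \<Gamma>1 \<union> \<Gamma>2 \<longrightarrow> u vs = ?d w vs"
  proof (cases m)
    case 0
    then show ?thesis
      using w1 w2 by (intro exI[of _ w1]) auto
  next
    case (Suc m')
    have "?d (\<lambda>ws. w1 ws - w2 ws) vs = 0" if "length vs = Suc m'" "set vs \<in> \<Gamma>1 \<inter> \<Gamma>2" for vs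
      using w1[of vs] w2[of vs] that Suc by (simp add: kd_diff)
    then obtain q where q: "\<And>vs. length vs = m' \<Longrightarrow> set vs \<in> \<Gamma>1 \<inter> \<Gamma>2 \<Longrightarrow> w1 vs - w2 vs = ?d q vs"
      by (rule acyclic_atE[OF int[OF Suc], of "\<lambda>ws. w1 ws - w2 ws"]) auto
    define w where "w = (\<lambda>vs. if set vs \<in> \<Gamma>1 then w1 vs else w2 vs + ?d q vs)"
    have "u vs = ?d w vs" if vs: "length vs = m" "set vs \<in> \<Gamma>1 \<union> \<Gamma>2" for vs
    proof (cases "set vs \<in> \<Gamma>1")
      case True
      have "?d w vs = ?d w1 vs"
        by (rule kd_cong_in[OF cl(1) True]) (use vs Suc in \<open>auto simp: w_def\<close>)
      then show ?thesis using w1 vs True by simp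
    next
      case False
      then have 2: "set vs \<in> \<Gamma>2" using vs by auto
      have "?d w vs = ?d (\<lambda>ws. w2 ws + ?d q ws) vs"
        by (rule kd_cong_in[OF cl(2) 2])
          (use vs Suc q in \<open>auto simp: w_def algebra_simps diff_eq_eq\<close>)
      also have "\<dots> = u vs"
        using w2 vs 2 kd_add[of "\<lambda>_. 1" w2 "?d q"] by (simp add: kd_kd)
      finally show ?thesis by simp
    qed
    then show ?thesis by blast
  qed
qed

text \<open>A class on \<open>\<Gamma>1\<close> that becomes the coboundary of \<open>\<eta>\<close>
  on the intersection extends over \<open>\<Gamma>2\<close> by that coboundary; a primitive of the
  extension would restrict to one of the class.\<close>

lemma not_acyclic_at_Un_extend:
  fixes T :: "'k::field itself"
  assumes cl: "subset_closed \<Gamma>1" "subset_closed \<Gamma>2"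
    and nac: "\<not> acyclic_at T \<Gamma>1 m" and int: "acyclic_at T (\<Gamma>1 \<inter> \<Gamma>2) m"
  shows "\<not> acyclic_at T (\<Gamma>1 \<union> \<Gamma>2) m"
proof
  let ?d = "kd (\<lambda>_. 1 :: 'k)"
  assume ac: "acyclic_at T (\<Gamma>1 \<union> \<Gamma>2) m"
  obtain u where u: "\<And>vs. length vs = Suc m \<Longrightarrow> set vs \<in> \<Gamma>1 \<Longrightarrow> ?d u vs = 0"
    and nu: "\<And>w. \<exists>vs. length vs = m \<and> set vs \<in> \<Gamma>1 \<and> u vs \<noteq> ?d w vs"
    by (rule not_acyclic_atE[OF nac]) blast
  obtain \<eta> where \<eta>: "\<And>vs. length vs = m \<Longrightarrow> set vs \<in> \<Gamma>1 \<inter> \<Gamma>2 \<Longrightarrow> u vs = ?d \<eta> vs"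
    by (rule acyclic_atE[OF int, of u]) (use u in auto)
  define u' where "u' = (\<lambda>vs. if set vs \<in> \<Gamma>1 then u vs else ?d \<eta> vs)"
  have "?d u' vs = 0" if vs: "length vs = Suc m" "set vs \<in> \<Gamma>1 \<union> \<Gamma>2" for vs
  proof (cases "set vs \<in> \<Gamma>1")
    case True
    have "?d u' vs = ?d u vs"
      by (rule kd_cong_in[OF cl(1) True]) (use vs in \<open>auto simp: u'_def\<close>)
    then show ?thesis using u vs True by simp
  next
    case False
    then have 2: "set vs \<in> \<Gamma>2" using vs by auto
    have "?d u' vs = ?d (?d \<eta>) vs"
      by (rule kd_cong_in[OF cl(2) 2]) (use vs \<eta> in \<open>auto simp: u'_def\<close>)
    then show ?thesis by (simp add: kd_kd)
  qed
  then obtain w where w: "\<And>vs. length vs = m \<Longrightarrow> set vs \<in> \<Gamma>1 \<union> \<Gamma>2 \<Longrightarrow> u' vs = ?d w vs"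
    by (rule acyclic_atE[OF ac, of u']) auto
  then have "u vs = ?d w vs" if "length vs = m" "set vs \<in> \<Gamma>1" for vs
    using that unfolding u'_def by (metis UnI1)
  then show False
    using nu[of w] by blast
qed

text \<open>Injectivity of the connecting map. The witness \<open>u\<close> is formally the
  coboundary of "0 on \<open>\<Gamma>1\<close>, \<open>\<theta>\<close> on
  \<open>\<Gamma>2\<close>", which is inconsistent on the overlap although its coboundary is
  not.\<close>

lemma not_acyclic_at_Un_connecting:
  fixes T :: "'k::field itself"
  assumes cl: "subset_closed \<Gamma>1" "subset_closed \<Gamma>2"
    and ac: "acyclic_at T \<Gamma>1 m" "acyclic_at T \<Gamma>2 m"
    and int: "\<not> acyclic_at T (\<Gamma>1 \<inter> \<Gamma>2) m"
  shows "\<not> acyclic_at T (\<Gamma>1 \<union> \<Gamma>2) (Suc m)"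
proof
  let ?d = "kd (\<lambda>_. 1 :: 'k)"
  assume acU: "acyclic_at T (\<Gamma>1 \<union> \<Gamma>2) (Suc m)"
  obtain \<theta> where \<theta>: "\<And>vs. length vs = Suc m \<Longrightarrow> set vs \<in> \<Gamma>1 \<inter> \<Gamma>2 \<Longrightarrow> ?d \<theta> vs = 0"
    and n\<theta>: "\<And>w. \<exists>vs. length vs = m \<and> set vs \<in> \<Gamma>1 \<inter> \<Gamma>2 \<and> \<theta> vs \<noteq> ?d w vs"
    by (rule not_acyclic_atE[OF int]) blast
  define u where "u = (\<lambda>vs. if set vs \<in> \<Gamma>1 then 0 else ?d \<theta> vs)"
  have "?d u vs = 0" if vs: "length vs = Suc (Suc m)" "set vs \<in> \<Gamma>1 \<union> \<Gamma>2" for vs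
  proof (cases "set vs \<in> \<Gamma>1")
    case True
    have "?d u vs = ?d (\<lambda>_. 0) vs"
      by (rule kd_cong_in[OF cl(1) True]) (use vs in \<open>auto simp: u_def\<close>)
    then show ?thesis by simp
  next
    case False
    then have 2: "set vs \<in> \<Gamma>2" using vs by auto
    have "?d u vs = ?d (?d \<theta>) vs"
      by (rule kd_cong_in[OF cl(2) 2]) (use vs \<theta> in \<open>auto simp: u_def\<close>)
    then show ?thesis by (simp add: kd_kd)
  qed
  then obtain w where w: "\<And>vs. length vs = Suc m \<Longrightarrow> set vs \<in> \<Gamma>1 \<union> \<Gamma>2 \<Longrightarrow> u vs = ?d w vs"
    by (rule acyclic_atE[OF acU, of u]) auto
  have "?d w vs = 0" if "length vs = Suc m" "set vs \<in> \<Gamma>1" for vs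
    using w[of vs] that unfolding u_def by simp
  then obtain q1 where q1: "\<And>vs. length vs = m \<Longrightarrow> set vs \<in> \<Gamma>1 \<Longrightarrow> w vs = ?d q1 vs"
    by (rule acyclic_atE[OF ac(1), of w]) auto
  have "?d (\<lambda>ws. \<theta> ws - w ws) vs = 0" if "length vs = Suc m" "set vs \<in> \<Gamma>2" for vs
    using w[of vs] that \<theta>[of vs] unfolding u_def by (simp add: kd_diff split: if_splits)
  then obtain q2 where q2: "\<And>vs. length vs = m \<Longrightarrow> set vs \<in> \<Gamma>2 \<Longrightarrow> \<theta> vs - w vs = ?d q2 vs"
    by (rule acyclic_atE[OF ac(2), of "\<lambda>ws. \<theta> ws - w ws"]) auto
  \<comment> \<open>On the overlap \<open>w\<close> and \<open>\<theta> - w\<close> are both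
    coboundaries, hence so is \<open>\<theta>\<close>.\<close>
  have "\<theta> vs = ?d (\<lambda>ws. q1 ws + q2 ws) vs" if "length vs = m" "set vs \<in> \<Gamma>1 \<inter> \<Gamma>2" for vs
    using q1[of vs] q2[of vs] that by (simp add: kd_add algebra_simps)
  then show False
    using n\<theta>[of "\<lambda>ws. q1 ws + q2 ws"] by blast
qed

section \<open>Spheres attached to families of disjoint blocks\<close>

definition missing :: "'w set \<Rightarrow> 'w set set \<Rightarrow> 'w set set" where
  "missing E \<Q> = {A. A \<subseteq> E \<and> (\<exists>T\<in>\<Q>. T \<inter> A = {})}"

lemma subset_closed_missing: "subset_closed (missing E \<Q>)"
  unfolding subset_closed_def missing_def by blast

lemma subset_closed_Pow: "subset_closed (Pow E)"
  unfolding subset_closed_def by blast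

text \<open>For blocks covering \<open>E\<close> this complex is the join of the boundaries of simplices dual to
  the blocks: a sphere of dimension \<open>card \<Q> - 2\<close> up to homotopy. Otherwise it is a cone.\<close>
lemma acyclic_at_missing:
  fixes T :: "'k::field itself"
  assumes "finite \<Q>" "\<And>B. B \<in> \<Q> \<Longrightarrow> B \<noteq> {} \<and> B \<subseteq> E"
    and "\<And>B B'. B \<in> \<Q> \<Longrightarrow> B' \<in> \<Q> \<Longrightarrow> B \<noteq> B' \<Longrightarrow> B \<inter> B' = {}"
  shows "acyclic_at T (missing E \<Q>) m \<longleftrightarrow> \<Union>\<Q> \<noteq> E \<or> Suc m \<noteq> card \<Q>"
proof -
  have cone: "acyclic_at T (missing E \<Q>) m" if "\<Union>\<Q> \<subseteq> E" "\<Union>\<Q> \<noteq> E" for E and \<Q> :: "'a set set" and m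
  proof -
    have "\<exists>p. p \<in> E \<and> p \<notin> \<Union>\<Q>" using that by blast
    then obtain p where "p \<in> E" "p \<notin> \<Union>\<Q>" by blast
    then show ?thesis
      by (intro acyclic_at_cone[of _ p]) (auto simp: missing_def)
  qed
  have sphere: "acyclic_at T (missing (\<Union>\<Q>) \<Q>) m \<longleftrightarrow> Suc m \<noteq> card \<Q>"
    using assms(1) assms(2)[THEN conjunct1] assms(3)
  proof (induction \<Q> arbitrary: m rule: finite_induct)
    case empty
    then show ?case by (simp add: missing_def)
  next
    case (insert B \<Q>)
    let ?E = "\<Union>(insert B \<Q>)"
    have disj: "B \<inter> \<Union>\<Q> = {}"
      using insert.prems(2)[of B] insert.hyps by auto
    have ne: "B \<noteq> {}" using insert.prems by auto
    \<comment> \<open>\<open>missing ?E \<Q>\<close> is a cone with any apex in \<open>B\<close>,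
      and missing \<open>B\<close> means lying in the full simplex on \<open>\<Union>\<Q>\<close>.
      For nonempty \<open>\<Q>\<close> both pieces are contractible and meet in the smaller sphere,
      so each block raises the dimension by one.\<close>
    have un: "missing ?E (insert B \<Q>) = missing ?E \<Q> \<union> Pow (\<Union>\<Q>)"
      using disj unfolding missing_def by auto
    have int: "missing ?E \<Q> \<inter> Pow (\<Union>\<Q>) = missing (\<Union>\<Q>) \<Q>"
      unfolding missing_def by auto
    have IH: "acyclic_at T (missing (\<Union>\<Q>) \<Q>) m \<longleftrightarrow> Suc m \<noteq> card \<Q>" for m
      by (rule insert.IH) (use insert.prems in auto)
    have c: "acyclic_at T (missing ?E \<Q>) m" for m
      by (rule cone) (use disj ne in auto, blast)
    show ?case
    \<comment> \<open>For a single block the simplex on \<open>\<Union>\<Q>\<close> degenerates to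
      \<open>{{}}\<close>, the sphere of dimension -1, where the suspensions start; without any
      block the complex is void.\<close>
    proof (cases "\<Q> = {}")
      case True
      have "acyclic_at T {{}} m \<longleftrightarrow> m \<noteq> 0"
        unfolding acyclic_at_def by (cases m) (auto intro: exI[of _ "\<lambda>_. 1"])
      moreover have "missing B {B} = {{}}"
        using ne unfolding missing_def by auto
      ultimately show ?thesis using True by simp
    next
      case False
      then have P: "acyclic_at T (Pow (\<Union>\<Q>)) m" for m
        using insert.prems(1) by (intro acyclic_at_Pow) auto
      have cl: "subset_closed (missing ?E \<Q>)" "subset_closed (Pow (\<Union>\<Q>))"
        by (rule subset_closed_missing subset_closed_Pow)+
      show ?thesis
      proof
        assume L: "acyclic_at T (missing ?E (insert B \<Q>)) m"
        show "Suc m \<noteq> card (insert B \<Q>)"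
        proof
          assume "Suc m = card (insert B \<Q>)"
          then have m: "m = card \<Q>" using insert.hyps by simp
          then obtain m' where m': "m = Suc m'" using False insert.hyps
            by (metis card_eq_0_iff not0_implies_Suc)
          show False
            using not_acyclic_at_Un_connecting[OF cl c P, of m'] IH[of m'] m m' L un int by simp
        qed
      next
        assume "Suc m \<noteq> card (insert B \<Q>)"
        then have "Suc m' \<noteq> card \<Q>" if "m = Suc m'" for m'
          using that insert.hyps by simp
        then show "acyclic_at T (missing ?E (insert B \<Q>)) m"
          unfolding un using IH int by (intro acyclic_at_Un[OF cl c P]) simp
      qed
    qed
  qed
  show ?thesis
    using sphere cone[of \<Q> E m] assms(2) by (cases "\<Union>\<Q> = E") auto
qed

section \<open>Links in a block shelling\<close>

text \<open>The blocks in \<open>Q j\<close> are the complements \<open>F\<^sub>j - \<sigma>\<close> of the facets \<open>\<sigma>\<close> of \<open>\<Delta>\<^sub>j\<close>.\<close>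
locale block_shelling =
  fixes k d :: nat and Fs :: "'w set list" and Q :: "nat \<Rightarrow> 'w set set"
  assumes k_pos: "k > 0"
    and facet: "j < length Fs \<Longrightarrow> finite (Fs ! j) \<and> card (Fs ! j) = d"
    and block: "j < length Fs \<Longrightarrow> B \<in> Q j \<Longrightarrow> B \<subseteq> Fs ! j \<and> card B = k"
    and disjoint: "j < length Fs \<Longrightarrow> B \<in> Q j \<Longrightarrow> B' \<in> Q j \<Longrightarrow> B \<noteq> B' \<Longrightarrow> B \<inter> B' = {}"
    and shell: "j < length Fs \<Longrightarrow> A \<subseteq> Fs ! j \<Longrightarrow>
      (\<exists>l<j. A \<subseteq> Fs ! l) \<longleftrightarrow> (\<exists>B\<in>Q j. B \<inter> A = {})"
begin

definition core :: "nat \<Rightarrow> 'w set" where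
  "core j = Fs ! j - \<Union>(Q j)"

lemma finite_blocks:
  assumes "j < length Fs"
  shows "finite (Q j)"
proof (rule finite_subset)
  show "Q j \<subseteq> Pow (Fs ! j)" using block[OF assms] by blast
  show "finite (Pow (Fs ! j))" using facet[OF assms] by simp
qed

lemma card_blocks:
  assumes "j < length Fs" "R \<subseteq> Q j"
  shows "card (\<Union>R) = k * card R"
proof -
  have "finite R" using assms finite_blocks finite_subset by blast
  moreover have "card (\<Union>R) = sum card R"
  proof (rule card_Union_disjoint)
    show "pairwise disjnt R"
      unfolding pairwise_def disjnt_def using disjoint[OF assms(1)] assms(2) by blast
    show "finite B" if "B \<in> R" for B
      using block[OF assms(1)] facet[OF assms(1)] that assms(2) finite_subset by blast
  qed
  moreover have "sum card R = (\<Sum>B\<in>R. k)"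
    by (rule sum.cong) (use block[OF assms(1)] assms(2) in auto)
  ultimately show ?thesis by simp
qed

lemma card_core:
  assumes "j < length Fs"
  shows "card (core j) + k * card (Q j) = d"
proof -
  have sub: "\<Union>(Q j) \<subseteq> Fs ! j" using block[OF assms] by blast
  have "card (Fs ! j) = card (core j) + card (\<Union>(Q j))"
    unfolding core_def using sub facet[OF assms] card_mono[of "Fs ! j" "\<Union>(Q j)"]
    by (simp add: card_Diff_subset finite_subset)
  then show ?thesis
    using card_blocks[OF assms subset_refl] facet[OF assms] by simp
qed

text \<open>The link of \<open>G\<close> in the complex of the first \<open>i\<close> facets. It is
  void, not \<open>{{}}\<close>, while none of them contains \<open>G\<close>, so inductions over
  \<open>i\<close> start from an acyclic complex.\<close>

definition link_before :: "nat \<Rightarrow> 'w set \<Rightarrow> 'w set set" where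
  "link_before i G = {A. A \<inter> G = {} \<and> (\<exists>l<i. A \<union> G \<subseteq> Fs ! l)}"

lemma subset_closed_link_before: "subset_closed (link_before i G)"
  unfolding subset_closed_def link_before_def by blast

lemma link_before_Suc:
  "link_before (Suc i) G = (if G \<subseteq> Fs ! i then link_before i G \<union> Pow (Fs ! i - G) else link_before i G)"
  unfolding link_before_def by (auto simp: less_Suc_eq)

text \<open>The shelling condition applied to \<open>A \<union> G\<close>: a block missed by this
  set is in particular disjoint from \<open>G\<close>.\<close>

lemma link_before_Int:
  assumes "i < length Fs" "G \<subseteq> Fs ! i"
  shows "link_before i G \<inter> Pow (Fs ! i - G) = missing (Fs ! i - G) {B \<in> Q i. B \<inter> G = {}}"
proof (rule set_eqI)
  fix A
  show "A \<in> link_before i G \<inter> Pow (Fs ! i - G) \<longleftrightarrow> A \<in> missing (Fs ! i - G) {B \<in> Q i. B \<inter> G = {}}"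
  proof (cases "A \<subseteq> Fs ! i - G")
    case True
    then have "(\<exists>l<i. A \<union> G \<subseteq> Fs ! l) \<longleftrightarrow> (\<exists>B\<in>Q i. B \<inter> (A \<union> G) = {})"
      using assms by (intro shell) auto
    then show ?thesis
      using True unfolding link_before_def missing_def by (auto simp: Int_Un_distrib)
  qed (auto simp: missing_def)
qed

text \<open>Adding a facet to the link of \<open>core j\<close> attaches it along a cone or along a homotopy sphere of
  dimension \<open>card (Q j) - 2\<close>; the latter happens for the facet \<open>Fs ! j\<close> itself.\<close>
lemma not_acyclic_at_link_core:
  fixes T :: "'k::field itself"
  assumes j: "j < length Fs"
  shows "\<not> acyclic_at T (link_before (length Fs) (core j)) (card (Q j))"
proof -
  define G where "G = core j"
  define p where "p = card (Q j)"
  note cl = subset_closed_link_before subset_closed_Pow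
  have GF: "G \<subseteq> Fs ! j" unfolding G_def core_def by blast
  have cardG: "card (Fs ! i - G) = k * p" if "i < length Fs" "G \<subseteq> Fs ! i" for i
  proof -
    have "card (Fs ! i - G) = d - card G"
      using facet[OF that(1)] that(2) by (simp add: card_Diff_subset finite_subset)
    then show ?thesis using card_core[OF j] unfolding G_def p_def by simp
  qed
  \<comment> \<open>If the blocks of \<open>Fs ! i\<close> off \<open>G\<close> fill
    \<open>Fs ! i - G\<close>, counting gives exactly \<open>p\<close> of them, because facets and
    blocks have constant size. Thus every gluing is along a complex that is acyclic except possibly
    in the one degree \<open>p - 1\<close>.\<close>
  have miss: "acyclic_at T (missing (Fs ! i - G) {B \<in> Q i. B \<inter> G = {}}) m \<longleftrightarrow>
      \<Union>{B \<in> Q i. B \<inter> G = {}} \<noteq> Fs ! i - G \<or> Suc m \<noteq> p"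
    if i: "i < length Fs" "G \<subseteq> Fs ! i" for i m
  proof -
    let ?Q = "{B \<in> Q i. B \<inter> G = {}}"
    have "card ?Q = p" if "\<Union>?Q = Fs ! i - G"
    proof -
      have "k * card ?Q = card (Fs ! i - G)"
        using card_blocks[OF i(1), of ?Q] that by auto
      then show ?thesis using cardG[OF i] k_pos by simp
    qed
    moreover have "acyclic_at T (missing (Fs ! i - G) ?Q) m \<longleftrightarrow>
        \<Union>?Q \<noteq> Fs ! i - G \<or> Suc m \<noteq> card ?Q"
    proof (rule acyclic_at_missing)
      show "finite ?Q" using finite_blocks[OF i(1)] by simp
      show "B \<noteq> {} \<and> B \<subseteq> Fs ! i - G" if "B \<in> ?Q" for B
        using block[OF i(1), of B] k_pos that by auto
      show "B \<inter> B' = {}" if "B \<in> ?Q" "B' \<in> ?Q" "B \<noteq> B'" for B B'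
        using disjoint[OF i(1)] that by blast
    qed
    ultimately show ?thesis by (cases "\<Union>?Q = Fs ! i - G") auto
  qed
  show ?thesis
  proof (cases p)
    \<comment> \<open>Without blocks \<open>core j\<close> is a whole facet, and a facet containing
      it equals it by cardinality. The link is \<open>{{}}\<close>, whose class lives on the empty
      list.\<close>
    case 0
    then have "G = Fs ! j"
      using finite_blocks[OF j] unfolding p_def G_def core_def by simp
    have "A = {}" if A: "A \<in> link_before (length Fs) G" for A
    proof -
      obtain l where l: "l < length Fs" "A \<inter> G = {}" "A \<union> G \<subseteq> Fs ! l"
        using A unfolding link_before_def by blast
      have "G = Fs ! l"
        by (rule card_subset_eq) (use \<open>G = Fs ! j\<close> facet[OF j] facet[OF l(1)] l(3) in auto)
      then show ?thesis using l by blast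
    qed
    moreover have "{} \<in> link_before (length Fs) G"
      using GF j unfolding link_before_def by auto
    ultimately have "link_before (length Fs) G = {{}}" by blast
    then show ?thesis
      using 0 unfolding G_def p_def acyclic_at_def by (simp, intro exI[of _ "\<lambda>_. 1"], simp)
  next
    case (Suc m)
    have ne: "Fs ! i - G \<noteq> {}" if "i < length Fs" "G \<subseteq> Fs ! i" for i
    proof
      assume "Fs ! i - G = {}"
      then have "card (Fs ! i - G) = 0" by (simp only: card.empty)
      then show False using cardG[OF that] Suc k_pos by simp
    qed
    \<comment> \<open>The connecting map at stage \<open>j\<close> needs the link built so far to be
      acyclic one degree below \<open>p\<close>. Each gluing is along a complex acyclic in degree
      \<open>m - 1\<close>, since a class of it can only sit in degree
      \<open>m = p - 1\<close>.\<close>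
    have below: "acyclic_at T (link_before i G) m" if "i \<le> length Fs" for i
      using that
    proof (induction i)
      case 0
      then show ?case by (simp add: link_before_def)
    next
      case (Suc i)
      show ?case
      proof (cases "G \<subseteq> Fs ! i")
        case True
        have i: "i < length Fs" using Suc.prems by simp
        have "acyclic_at T (link_before i G \<union> Pow (Fs ! i - G)) m"
        proof (rule acyclic_at_Un[OF cl])
          show "acyclic_at T (link_before i G) m" using Suc by simp
          show "acyclic_at T (Pow (Fs ! i - G)) m" by (rule acyclic_at_Pow[OF ne[OF i True]])
          show "acyclic_at T (link_before i G \<inter> Pow (Fs ! i - G)) m'" if "m = Suc m'" for m'
            using miss[OF i True, of m'] \<open>p = Suc m\<close> that
            by (simp add: link_before_Int[OF i True])
        qed
        then show ?thesis using True by (simp add: link_before_Suc)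
      next
        case False
        then show ?thesis using Suc by (simp add: link_before_Suc)
      qed
    qed
    have "{B \<in> Q j. B \<inter> G = {}} = Q j" unfolding G_def core_def by blast
    moreover have "\<Union>(Q j) = Fs ! j - G"
      unfolding G_def core_def using block[OF j] by blast
    ultimately have "\<not> acyclic_at T (link_before j G \<inter> Pow (Fs ! j - G)) m"
      using miss[OF j GF, of m] Suc by (simp add: link_before_Int[OF j GF])
    then have start: "\<not> acyclic_at T (link_before (Suc j) G) p"
      using not_acyclic_at_Un_connecting[OF cl below acyclic_at_Pow[OF ne[OF j GF]]] j Suc GF
      by (simp add: link_before_Suc)
    \<comment> \<open>The class persists through all later gluings, as these are along complexes
      acyclic in degree \<open>p\<close>.\<close>
    have "\<not> acyclic_at T (link_before i G) p" if "Suc j \<le> i" "i \<le> length Fs" for i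
      using that
    proof (induction i rule: dec_induct)
      case base
      then show ?case using start by simp
    next
      case (step i)
      then have i: "i < length Fs" and IH: "\<not> acyclic_at T (link_before i G) p" by simp_all
      show ?case
      proof (cases "G \<subseteq> Fs ! i")
        case True
        have "acyclic_at T (link_before i G \<inter> Pow (Fs ! i - G)) p"
          using miss[OF i True, of p] by (simp add: link_before_Int[OF i True])
        then show ?thesis
          using not_acyclic_at_Un_extend[OF cl IH] True by (simp add: link_before_Suc)
      next
        case False
        then show ?thesis using IH by (simp add: link_before_Suc)
      qed
    qed
    then show ?thesis using j unfolding G_def p_def by simp
  qed
qed

end

section \<open>Polynomial ideals and Koszul vanishing\<close>

lemma keys_add_nat: "Poly_Mapping.keys (a + b) = Poly_Mapping.keys a \<union> Poly_Mapping.keys (b :: 'w \<Rightarrow>\<^sub>0 nat)"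
  by (auto simp: in_keys_iff lookup_add)

lemma poly_eq_sum_monomials:
  "(p :: ('w, 'k::field) mpoly) = (\<Sum>m\<in>Poly_Mapping.keys p. Poly_Mapping.single m (Poly_Mapping.lookup p m))"
  by (rule poly_mapping_eqI) (auto simp: lookup_sum lookup_single when_def in_keys_iff)

lemma lookup_single_mult_add:
  fixes p :: "('w, 'k::field) mpoly"
  shows "Poly_Mapping.lookup (Poly_Mapping.single a c * p) (a + m) = c * Poly_Mapping.lookup p m"
proof -
  have "Poly_Mapping.single a c * p =
      (\<Sum>b\<in>Poly_Mapping.keys p. Poly_Mapping.single (a + b) (c * Poly_Mapping.lookup p b))"
    by (subst poly_eq_sum_monomials[of p]) (simp add: sum_distrib_left mult_single)
  then show ?thesis
    by (auto simp: lookup_sum lookup_single when_def in_keys_iff)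
qed

lemma keys_single_mult:
  fixes p :: "('w, 'k::field) mpoly"
  shows "Poly_Mapping.keys (Poly_Mapping.single a c * p) \<subseteq> (+) a ` Poly_Mapping.keys p"
proof
  fix m assume "m \<in> Poly_Mapping.keys (Poly_Mapping.single a c * p)"
  then obtain b where "m = a + b" "b \<in> Poly_Mapping.keys p"
    using keys_mult[of "Poly_Mapping.single a c" p] by (auto split: if_splits)
  then show "m \<in> (+) a ` Poly_Mapping.keys p" by blast
qed

lemma polys_0 [simp]: "0 \<in> polys V"
  and polys_1 [simp]: "1 \<in> polys V"
  by (auto simp: polys_def)

lemma polys_single [simp]: "Poly_Mapping.keys m \<subseteq> V \<Longrightarrow> Poly_Mapping.single m c \<in> polys V"
  by (auto simp: polys_def split: if_splits)

lemma polys_add [simp]: "p \<in> polys V \<Longrightarrow> q \<in> polys V \<Longrightarrow> p + q \<in> polys V"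
  unfolding polys_def using keys_add[of p q] by blast

lemma polys_diff [simp]: "p \<in> polys V \<Longrightarrow> q \<in> polys V \<Longrightarrow> p - q \<in> polys V"
  unfolding polys_def using keys_diff[of p q] by blast

lemma polys_uminus [simp]: "p \<in> polys V \<Longrightarrow> - p \<in> polys V"
  using polys_diff[of 0 V p] by simp

lemma polys_mult [simp]: "p \<in> polys V \<Longrightarrow> q \<in> polys V \<Longrightarrow> p * q \<in> polys V"
  unfolding polys_def using keys_mult[of p q] by (force simp: keys_add_nat)

lemma polys_power [simp]: "p \<in> polys V \<Longrightarrow> p ^ n \<in> polys V"
  by (induction n) auto

lemma polys_sum: "(\<And>i. i \<in> A \<Longrightarrow> f i \<in> polys V) \<Longrightarrow> sum f A \<in> polys V"
  by (induction A rule: infinite_finite_induct) auto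

lemma polys_var [simp]: "v \<in> V \<Longrightarrow> var v \<in> polys V"
  unfolding var_def by simp

definition ideal_of :: "('w, 'k::field) mpoly set \<Rightarrow> ('w, 'k) mpoly set \<Rightarrow> bool" where
  "ideal_of R J \<longleftrightarrow> J \<subseteq> R \<and> 0 \<in> J \<and> (\<forall>p\<in>J. \<forall>q\<in>J. p + q \<in> J) \<and> (\<forall>r\<in>R. \<forall>p\<in>J. r * p \<in> J)"

lemma ideal_ofD:
  assumes "ideal_of (polys V) J"
  shows "J \<subseteq> polys V" "0 \<in> J" "p \<in> J \<Longrightarrow> q \<in> J \<Longrightarrow> p + q \<in> J"
    "p \<in> J \<Longrightarrow> q \<in> J \<Longrightarrow> p - q \<in> J" "r \<in> polys V \<Longrightarrow> p \<in> J \<Longrightarrow> r * p \<in> J"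
    "p \<in> J \<Longrightarrow> - p \<in> J"
proof -
  show "J \<subseteq> polys V" "0 \<in> J" "p \<in> J \<Longrightarrow> q \<in> J \<Longrightarrow> p + q \<in> J" "r \<in> polys V \<Longrightarrow> p \<in> J \<Longrightarrow> r * p \<in> J" for p q r
    using assms unfolding ideal_of_def by auto
  from this(4)[of "-1"] have neg: "q \<in> J \<Longrightarrow> - q \<in> J" for q by simp
  then show "p \<in> J \<Longrightarrow> - p \<in> J" .
  show "p \<in> J \<Longrightarrow> q \<in> J \<Longrightarrow> p - q \<in> J"
    using assms neg[of q] unfolding ideal_of_def by (metis diff_conv_add_uminus)
qed

lemma ideal_sum:
  assumes "ideal_of (polys V) J" "\<And>i. i \<in> A \<Longrightarrow> f i \<in> J"
  shows "sum f A \<in> J"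
  using assms(2)
  by (induction A rule: infinite_finite_induct) (auto simp: ideal_ofD[OF assms(1)])

lemma gen_ideal_mem:
  assumes "g \<in> G" "c \<in> R"
  shows "c * g \<in> gen_ideal R G"
  unfolding gen_ideal_def using assms by (auto intro!: exI[of _ "{g}"] exI[of _ "\<lambda>_. c"])

lemma gen_ideal_least:
  assumes "ideal_of (polys V) J" "G \<subseteq> J"
  shows "gen_ideal (polys V) G \<subseteq> J"
  unfolding gen_ideal_def using assms(2) by (auto intro!: ideal_sum[OF assms(1)] ideal_ofD[OF assms(1)])

lemma gen_ideal_ideal:
  fixes G :: "('w, 'k::field) mpoly set"
  assumes "G \<subseteq> polys V"
  shows "ideal_of (polys V) (gen_ideal (polys V) G)"
  unfolding ideal_of_def
proof (intro conjI ballI)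
  show "gen_ideal (polys V) G \<subseteq> polys V"
    unfolding gen_ideal_def using assms by (auto intro!: polys_sum polys_mult)
  show "0 \<in> gen_ideal (polys V) G"
    unfolding gen_ideal_def by (auto intro!: exI[of _ "{}"])
next
  fix p q assume "p \<in> gen_ideal (polys V) G" "q \<in> gen_ideal (polys V) G"
  then obtain F c F' c' where *: "finite F" "F \<subseteq> G" "\<forall>g\<in>F. c g \<in> polys V" "p = (\<Sum>g\<in>F. c g * g)"
     "finite F'" "F' \<subseteq> G" "\<forall>g\<in>F'. c' g \<in> polys V" "q = (\<Sum>g\<in>F'. c' g * g)"
    unfolding gen_ideal_def by auto
  define e where "e = (\<lambda>g. (if g \<in> F then c g else 0) + (if g \<in> F' then c' g else 0))"
  have "p = (\<Sum>g\<in>F \<union> F'. (if g \<in> F then c g else 0) * g)"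
    unfolding *(4) using *(1,5) by (intro sum.mono_neutral_cong_left) auto
  moreover have "q = (\<Sum>g\<in>F \<union> F'. (if g \<in> F' then c' g else 0) * g)"
    unfolding *(8) using *(1,5) by (intro sum.mono_neutral_cong_left) auto
  ultimately have "p + q = (\<Sum>g\<in>F \<union> F'. e g * g)"
    by (simp add: e_def sum.distrib algebra_simps)
  moreover have "\<forall>g\<in>F \<union> F'. e g \<in> polys V"
    using *(3,7) unfolding e_def by (auto intro!: polys_add)
  ultimately show "p + q \<in> gen_ideal (polys V) G"
    unfolding gen_ideal_def using *(1,2,5,6) by blast
next
  fix r p :: "('w, 'k) mpoly"
  assume r: "r \<in> polys V" and "p \<in> gen_ideal (polys V) G"
  then obtain F c where *: "finite F" "F \<subseteq> G" "\<forall>g\<in>F. c g \<in> polys V" "p = (\<Sum>g\<in>F. c g * g)"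
    unfolding gen_ideal_def by auto
  have "r * p = (\<Sum>g\<in>F. (r * c g) * g)"
    unfolding *(4) by (simp add: sum_distrib_left mult.assoc)
  moreover have "\<forall>g\<in>F. r * c g \<in> polys V" using r *(3) by simp
  ultimately show "r * p \<in> gen_ideal (polys V) G"
    unfolding gen_ideal_def using *(1,2) by (auto intro!: exI[of _ F] exI[of _ "\<lambda>g. r * c g"])
qed

lemma gen_ideal_superset: "G \<subseteq> gen_ideal (polys V) G"
  using gen_ideal_mem[of _ G 1 "polys V"] by auto

lemma gen_ideal_id: "ideal_of (polys V) J \<Longrightarrow> gen_ideal (polys V) J = J"
  using gen_ideal_least gen_ideal_superset by (metis subset_antisym subset_refl)

text \<open>Lets an induction along a regular sequence pass from \<open>J\<close> to
  \<open>J + (f)\<close> while the tail of the sequence keeps its ideals.\<close>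

lemma gen_ideal_insert_Un:
  assumes "J \<subseteq> polys V" "f \<in> polys V" "S \<subseteq> polys V"
  shows "gen_ideal (polys V) (gen_ideal (polys V) (insert f J) \<union> S) = gen_ideal (polys V) (J \<union> insert f S)"
    (is "?L = ?R")
proof
  have sub: "gen_ideal (polys V) (insert f J) \<subseteq> polys V"
    using gen_ideal_ideal[of "insert f J" V] assms ideal_ofD(1) by blast
  have R: "ideal_of (polys V) ?R" "J \<union> insert f S \<subseteq> ?R"
    using assms by (intro gen_ideal_ideal gen_ideal_superset; auto)+
  have L: "ideal_of (polys V) ?L" "gen_ideal (polys V) (insert f J) \<union> S \<subseteq> ?L"
    using assms sub by (intro gen_ideal_ideal gen_ideal_superset; auto)+
  show "?L \<subseteq> ?R"
    by (rule gen_ideal_least[OF R(1)]) (use R(2) gen_ideal_least[OF R(1), of "insert f J"] in auto)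
  show "?R \<subseteq> ?L"
    by (rule gen_ideal_least[OF L(1)]) (use L(2) gen_ideal_superset[of "insert f J" V] in auto)
qed

lemma gen_ideal_insertE:
  assumes J: "ideal_of (polys V) J" and f: "f \<in> polys V" and p: "p \<in> gen_ideal (polys V) (insert f J)"
  obtains r :: "('w, 'k::field) mpoly" where "r \<in> polys V" "p - f * r \<in> J"
proof -
  let ?I = "{p \<in> polys V. \<exists>r\<in>polys V. p - f * r \<in> J}"
  have "ideal_of (polys V) ?I"
    unfolding ideal_of_def
  proof (intro conjI ballI)
    show "0 \<in> ?I" using ideal_ofD(2)[OF J] by (auto intro!: bexI[of _ 0])
    show "p + q \<in> ?I" if pq: "p \<in> ?I" "q \<in> ?I" for p q
    proof -
      obtain r s where "r \<in> polys V" "s \<in> polys V" "p - f * r \<in> J" "q - f * s \<in> J"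
        using pq by auto
      moreover have "p + q - f * (r + s) = (p - f * r) + (q - f * s)" by (simp add: algebra_simps)
      ultimately have "p + q - f * (r + s) \<in> J" "r + s \<in> polys V"
        using ideal_ofD(3)[OF J, of "p - f * r" "q - f * s"] by (simp_all only: polys_add)
      then show ?thesis using pq by auto
    qed
    show "s * p \<in> ?I" if s: "s \<in> polys V" "p \<in> ?I" for s p
    proof -
      obtain r where "r \<in> polys V" "p - f * r \<in> J" using s by auto
      moreover have "s * p - f * (s * r) = s * (p - f * r)" by (simp add: algebra_simps)
      ultimately show ?thesis
        using s ideal_ofD(5)[OF J] by (auto intro!: bexI[of _ "s * r"])
    qed
  qed auto
  moreover have "f \<in> ?I"
    using f ideal_ofD(2)[OF J] by (auto intro!: bexI[of _ 1])
  moreover have "J \<subseteq> ?I"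
    using ideal_ofD(1)[OF J] by (auto intro!: bexI[of _ 0])
  ultimately show thesis
    using gen_ideal_least[of V ?I "insert f J"] p that by auto
qed

text \<open>The multiplier \<open>c\<close> replaces the binomial theorem: one factor
  \<open>a + b\<close> is split over \<open>c\<close>, and the new multipliers \<open>a * c\<close>
  and \<open>b * c\<close> need one power of \<open>a\<close> or of \<open>b\<close> fewer.\<close>

lemma radical_add:
  assumes I: "ideal_of (polys V) I" and ab: "a \<in> polys V" "b \<in> polys V"
    and c: "c \<in> polys V" "a ^ n * c \<in> I" "b ^ m * c \<in> I"
  shows "(a + b) ^ (n + m) * c \<in> I"
  using c
proof (induction "n + m" arbitrary: n m c)
  case 0
  then show ?case by simp
next
  case (Suc N)
  show ?case
  proof (cases "n = 0 \<or> m = 0")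
    case True
    then have "c \<in> I" using Suc.prems by auto
    then show ?thesis using ab ideal_ofD(5)[OF I] by simp
  next
    case False
    then obtain n' m' where nm: "n = Suc n'" "m = Suc m'" by (metis not0_implies_Suc)
    have "(a + b) ^ (n' + m) * (a * c) \<in> I"
      using Suc.prems Suc.hyps(2) nm ab ideal_ofD(5)[OF I, of a "b ^ m * c"]
      by (intro Suc.hyps(1)) (auto simp: algebra_simps)
    moreover have "(a + b) ^ (n + m') * (b * c) \<in> I"
      using Suc.prems Suc.hyps(2) nm ab ideal_ofD(5)[OF I, of b "a ^ n * c"]
      by (intro Suc.hyps(1)) (auto simp: algebra_simps)
    moreover have "(a + b) ^ (n + m) * c = (a + b) ^ (n' + m) * (a * c) + (a + b) ^ (n + m') * (b * c)"
      by (simp add: nm algebra_simps)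
    ultimately show ?thesis using ideal_ofD(3)[OF I] by simp
  qed
qed

lemma radical_of_var_powers:
  assumes I: "ideal_of (polys V) I" and y: "\<And>v. v \<in> V \<Longrightarrow> var v ^ e v \<in> I"
    and f: "f \<in> gen_ideal (polys V) (var ` V)"
  shows "\<exists>N. f ^ N \<in> I"
proof -
  obtain F c where F: "finite F" "F \<subseteq> var ` V" "\<forall>g\<in>F. c g \<in> polys V" "f = (\<Sum>g\<in>F. c g * g)"
    using f unfolding gen_ideal_def by auto
  from F(1-3) have "\<exists>N. (\<Sum>g\<in>F. c g * g) ^ N \<in> I"
  proof (induction F rule: finite_induct)
    case empty
    then show ?case using ideal_ofD(2)[OF I] by (auto intro: exI[of _ 1])
  next
    case (insert g F)
    then obtain N v where N: "(\<Sum>g\<in>F. c g * g) ^ N \<in> I" and v: "g = var v" "v \<in> V"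
      by auto
    have "(c g * g) ^ e v \<in> I"
      using y[OF v(2)] ideal_ofD(5)[OF I] insert.prems v by (simp add: power_mult_distrib)
    moreover have "(\<Sum>g\<in>F. c g * g) \<in> polys V"
      using insert.prems by (auto intro!: polys_sum polys_mult)
    ultimately have "(c g * g + (\<Sum>g\<in>F. c g * g)) ^ (e v + N) * 1 \<in> I"
      using insert.prems v N by (intro radical_add[OF I]) auto
    then show ?case using insert.hyps by auto
  qed
  then show ?thesis using F(4) by simp
qed

text \<open>Depth sensitivity of the Koszul complex on powers of the variables. A member \<open>f\<close> of the
  maximal ideal has a power annihilating the cohomology, while \<open>f\<close> acts injectively on it by
  induction, since the cohomology modulo \<open>f\<close> vanishes one degree below.\<close>
lemma koszul_vanishing:
  fixes J :: "('w, 'k::field) mpoly set"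
  assumes "ideal_of (polys V) J" "set fs \<subseteq> gen_ideal (polys V) (var ` V)"
    and "\<And>i g. i < length fs \<Longrightarrow> g \<in> polys V \<Longrightarrow>
        fs ! i * g \<in> gen_ideal (polys V) (J \<union> set (take i fs)) \<Longrightarrow>
        g \<in> gen_ideal (polys V) (J \<union> set (take i fs))"
    and "m < length fs" "\<And>vs. z vs \<in> polys V"
    and "\<And>vs. length vs = Suc m \<Longrightarrow> set vs \<subseteq> V \<Longrightarrow> kd (\<lambda>v. var v ^ e v) z vs \<in> J"
  shows "\<exists>w. (\<forall>vs. w vs \<in> polys V) \<and>
    (\<forall>vs. length vs = m \<longrightarrow> set vs \<subseteq> V \<longrightarrow> z vs - kd (\<lambda>v. var v ^ e v) w vs \<in> J)"
  using assms
proof (induction fs arbitrary: J m z)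
  case Nil
  then show ?case by simp
next
  case (Cons f fs)
  let ?R = "polys V" and ?y = "\<lambda>v. var v ^ e v :: ('w, 'k) mpoly"
  note J = Cons.prems(1)
  define cob where "cob z \<longleftrightarrow> (\<exists>w. (\<forall>vs. w vs \<in> ?R) \<and>
    (\<forall>vs. length vs = m \<longrightarrow> set vs \<subseteq> V \<longrightarrow> z vs - kd ?y w vs \<in> J))" for z
  have "gen_ideal ?R (var ` V) \<subseteq> ?R"
    by (rule ideal_ofD(1)[OF gen_ideal_ideal]) auto
  then have f: "f \<in> ?R" "set fs \<subseteq> ?R" using Cons.prems(2) by auto
  have reg: "g \<in> J" if "g \<in> ?R" "f * g \<in> J" for g
    using Cons.prems(3)[of 0 g] that gen_ideal_id[OF J] by simp
  define J' where "J' = gen_ideal ?R (insert f J)"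
  have J': "ideal_of ?R J'"
    unfolding J'_def by (rule gen_ideal_ideal) (use f ideal_ofD(1)[OF J] in auto)
  have reg': "g \<in> gen_ideal ?R (J' \<union> set (take i fs))"
    if "i < length fs" "g \<in> ?R" "fs ! i * g \<in> gen_ideal ?R (J' \<union> set (take i fs))" for i g
  proof -
    have "set (take i fs) \<subseteq> ?R" using f set_take_subset by fast
    then have "gen_ideal ?R (J' \<union> set (take i fs)) = gen_ideal ?R (J \<union> set (take (Suc i) (f # fs)))"
      unfolding J'_def using gen_ideal_insert_Un[of J V f "set (take i fs)"] f ideal_ofD(1)[OF J] by simp
    then show ?thesis
      using Cons.prems(3)[of "Suc i" g] that by simp
  qed
  have kdJ: "kd ?y w vs \<in> J" if "set vs \<subseteq> V"
    "\<And>ws. set ws \<subseteq> V \<Longrightarrow> Suc (length ws) = length vs \<Longrightarrow> w ws \<in> J" for w vs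
    by (rule kd_closed) (use that in \<open>auto intro!: ideal_ofD[OF J]\<close>)
  have kdR: "kd ?y w vs \<in> ?R" if "set vs \<subseteq> V" "\<And>ws. w ws \<in> ?R" for w vs
    by (rule kd_closed) (use that in auto)
  \<comment> \<open>If \<open>f z'\<close> is \<open>kd w\<close> modulo \<open>J\<close>, then
    \<open>w\<close> is a cocycle modulo \<open>J' = J + (f)\<close> one degree lower, so by
    induction \<open>w = kd v + f u\<close> modulo \<open>J\<close>. Hence
    \<open>f (z' - kd u)\<close> lies in \<open>J\<close> and regularity cancels \<open>f\<close>.
    In degree 0 \<open>kd w\<close> vanishes and \<open>f\<close> cancels at once.\<close>
  have cancel: "cob z'" if z': "\<And>vs. z' vs \<in> ?R" and fz: "cob (\<lambda>vs. f * z' vs)" for z'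
  proof -
    obtain w where w: "\<And>vs. w vs \<in> ?R"
      "\<And>vs. length vs = m \<Longrightarrow> set vs \<subseteq> V \<Longrightarrow> f * z' vs - kd ?y w vs \<in> J"
      using fz unfolding cob_def by blast
    show ?thesis
    proof (cases m)
      case 0
      then have "z' [] \<in> J" using w(2)[of "[]"] reg[OF z'] by simp
      then show ?thesis unfolding cob_def using 0 by (auto intro!: exI[of _ "\<lambda>_. 0"])
    next
      case (Suc m')
      have "kd ?y w vs \<in> J'" if vs: "length vs = Suc m'" "set vs \<subseteq> V" for vs
      proof -
        have "f * z' vs \<in> J'"
          using gen_ideal_mem[of f "insert f J" "z' vs" ?R] z' unfolding J'_def by (simp add: mult.commute)
        moreover have "f * z' vs - kd ?y w vs \<in> J'"
          using w(2)[of vs] vs Suc gen_ideal_superset[of "insert f J" V] unfolding J'_def by auto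
        ultimately show ?thesis using ideal_ofD(4)[OF J', of "f * z' vs"] by fastforce
      qed
      then obtain v where v: "\<And>vs. v vs \<in> ?R"
        "\<And>vs. length vs = m' \<Longrightarrow> set vs \<subseteq> V \<Longrightarrow> w vs - kd ?y v vs \<in> J'"
        using Cons.IH[OF J' _ reg', of m' w] Cons.prems(2,4) Suc w(1) by auto
      have "\<exists>r\<in>?R. (length vs = m' \<longrightarrow> set vs \<subseteq> V \<longrightarrow> w vs - kd ?y v vs - f * r \<in> J)" for vs
      proof (cases "length vs = m' \<and> set vs \<subseteq> V")
        case True
        then show ?thesis
          using gen_ideal_insertE[OF J f(1) v(2)[of vs, unfolded J'_def]] by metis
      next
        case False
        then show ?thesis using polys_0 by blast
      qed
      then obtain u where u: "\<And>vs. u vs \<in> ?R" "\<And>vs. length vs = m' \<Longrightarrow> set vs \<subseteq> V \<Longrightarrow>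
          w vs - kd ?y v vs - f * u vs \<in> J"
        by metis
      have "z' vs - kd ?y u vs \<in> J" if vs: "length vs = m" "set vs \<subseteq> V" for vs
      proof (rule reg)
        show "z' vs - kd ?y u vs \<in> ?R" using z' kdR[OF vs(2) u(1)] by simp
        have "kd ?y (\<lambda>ws. w ws - kd ?y v ws - f * u ws) vs \<in> J"
          by (rule kdJ) (use vs u(2) Suc in auto)
        moreover have "kd ?y (\<lambda>ws. w ws - kd ?y v ws - f * u ws) vs = kd ?y w vs - f * kd ?y u vs"
          using kd_diff[of ?y "\<lambda>ws. w ws - kd ?y v ws" "\<lambda>ws. f * u ws" vs]
            kd_diff[of ?y w "kd ?y v" vs] by (simp add: kd_kd kd_scale)
        moreover have "f * (z' vs - kd ?y u vs) = (f * z' vs - kd ?y w vs) + (kd ?y w vs - f * kd ?y u vs)"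
          by (simp add: algebra_simps)
        ultimately show "f * (z' vs - kd ?y u vs) \<in> J"
          using ideal_ofD(3)[OF J w(2)[OF vs]] by (simp only:)
      qed
      then show ?thesis unfolding cob_def using u(1) by blast
    qed
  qed
  \<comment> \<open>The annihilator of the class of \<open>z\<close>. It contains each
    \<open>var v ^ e v\<close>, since prefixing \<open>v\<close> is a homotopy for multiplication by
    it; so it contains a power of \<open>f\<close>, whose factors are then cancelled one by
    one.\<close>
  define I where "I = {h \<in> ?R. cob (\<lambda>vs. h * z vs)}"
  have I: "ideal_of ?R I"
    unfolding ideal_of_def
  proof (intro conjI ballI)
    show "0 \<in> I"
      unfolding I_def cob_def using ideal_ofD(2)[OF J] by (auto intro!: exI[of _ "\<lambda>_. 0"])
    show "p + q \<in> I" if pq: "p \<in> I" "q \<in> I" for p q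
    proof -
      obtain w w' where "\<And>vs. w vs \<in> ?R" "\<And>vs. w' vs \<in> ?R"
        and *: "\<And>vs. length vs = m \<Longrightarrow> set vs \<subseteq> V \<Longrightarrow> p * z vs - kd ?y w vs \<in> J"
        "\<And>vs. length vs = m \<Longrightarrow> set vs \<subseteq> V \<Longrightarrow> q * z vs - kd ?y w' vs \<in> J"
        using pq unfolding I_def cob_def by blast
      moreover have "(p + q) * z vs - kd ?y (\<lambda>ws. w ws + w' ws) vs \<in> J"
        if "length vs = m" "set vs \<subseteq> V" for vs
        using ideal_ofD(3)[OF J *(1)[OF that] *(2)[OF that]] by (simp add: kd_add algebra_simps)
      ultimately show ?thesis
        using pq unfolding I_def cob_def by (auto intro!: exI[of _ "\<lambda>ws. w ws + w' ws"])
    qed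
    show "r * p \<in> I" if r: "r \<in> ?R" "p \<in> I" for r p
    proof -
      obtain w where "\<And>vs. w vs \<in> ?R"
        and *: "\<And>vs. length vs = m \<Longrightarrow> set vs \<subseteq> V \<Longrightarrow> p * z vs - kd ?y w vs \<in> J"
        using r unfolding I_def cob_def by blast
      moreover have "r * p * z vs - kd ?y (\<lambda>ws. r * w ws) vs \<in> J"
        if "length vs = m" "set vs \<subseteq> V" for vs
        using ideal_ofD(5)[OF J r(1) *[OF that]] by (simp add: kd_scale algebra_simps)
      ultimately show ?thesis
        using r unfolding I_def cob_def by (auto intro!: exI[of _ "\<lambda>ws. r * w ws"])
    qed
  qed (auto simp: I_def)
  have "var v ^ e v \<in> I" if "v \<in> V" for v
  proof -
    have "?y v * z vs - kd ?y (\<lambda>ws. z (v # ws)) vs \<in> J" if "length vs = m" "set vs \<subseteq> V" for vs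
      using Cons.prems(6)[of "v # vs"] that \<open>v \<in> V\<close> by simp
    then show ?thesis
      unfolding I_def cob_def using that Cons.prems(5)
      by (auto intro!: exI[of _ "\<lambda>ws. z (v # ws)"])
  qed
  then obtain N where N: "f ^ N \<in> I"
    using radical_of_var_powers[OF I] Cons.prems(2) by (metis list.set_intros(1) subsetD)
  have "f ^ N \<in> I \<Longrightarrow> 1 \<in> I" for N
  proof (induction N)
    case (Suc N)
    have "cob (\<lambda>vs. f ^ N * z vs)"
      by (rule cancel) (use Suc.prems f Cons.prems(5) in \<open>auto simp: I_def mult.assoc\<close>)
    then show ?case using Suc.IH f unfolding I_def by simp
  qed simp
  then have "cob z" using N unfolding I_def by auto
  then show ?case unfolding cob_def .
qed

section \<open>An upper bound for the depth\<close>

text \<open>The Stanley-Reisner ideal described by supports instead of generators, so that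
  membership is tested term by term. \<open>\<Delta>\<close> may contain sets that leave
  \<open>V\<close>, as happens for the expansion.\<close>

definition face_ideal :: "'w set \<Rightarrow> 'w set set \<Rightarrow> ('w, 'k::field) mpoly set" where
  "face_ideal V \<Delta> = {p \<in> polys V. \<forall>m\<in>Poly_Mapping.keys p. Poly_Mapping.keys m \<notin> \<Delta>}"

lemma ideal_face_ideal:
  assumes "subset_closed \<Delta>"
  shows "ideal_of (polys V) (face_ideal V \<Delta>)"
  unfolding ideal_of_def
proof (intro conjI ballI)
  show "p + q \<in> face_ideal V \<Delta>" if "p \<in> face_ideal V \<Delta>" "q \<in> face_ideal V \<Delta>"
    for p q :: "('a, 'b) mpoly"
    using that keys_add[of p q] unfolding face_ideal_def by auto
  show "r * p \<in> face_ideal V \<Delta>" if "r \<in> polys V" "p \<in> face_ideal V \<Delta>"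
    for r p :: "('a, 'b) mpoly"
  proof -
    have "Poly_Mapping.keys m \<notin> \<Delta>" if m: "m \<in> Poly_Mapping.keys (r * p)" for m
    proof -
      obtain a b where "m = a + b" "b \<in> Poly_Mapping.keys p"
        using m keys_mult[of r p] by blast
      then show ?thesis
        using \<open>p \<in> face_ideal V \<Delta>\<close> assms unfolding face_ideal_def subset_closed_def
        by (auto simp: keys_add_nat)
    qed
    then show ?thesis using that unfolding face_ideal_def by simp
  qed
qed (auto simp: face_ideal_def)

lemma lookup_face_ideal:
  "p \<in> face_ideal V \<Delta> \<Longrightarrow> Poly_Mapping.keys m \<in> \<Delta> \<Longrightarrow> Poly_Mapping.lookup p m = 0"
  unfolding face_ideal_def by (auto simp: in_keys_iff)

text \<open>Entries count with multiplicity: deleting \<open>v\<close> and multiplying by its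
  variable then preserves the fine degree on lists with repetitions too.\<close>

definition list_mon :: "'w list \<Rightarrow> 'w \<Rightarrow>\<^sub>0 nat" where
  "list_mon vs = sum_list (map (\<lambda>v. Poly_Mapping.single v 1) vs)"

lemma list_mon_simps [simp]:
  "list_mon [] = 0" "list_mon (v # vs) = Poly_Mapping.single v 1 + list_mon vs"
  by (simp_all add: list_mon_def)

lemma keys_list_mon [simp]: "Poly_Mapping.keys (list_mon vs) = set vs"
  by (induction vs) (auto simp: keys_add_nat)

lemma lookup_list_mon_distinct:
  "distinct vs \<Longrightarrow> Poly_Mapping.lookup (list_mon vs) v = (if v \<in> set vs then 1 else 0)"
  by (induction vs) (auto simp: lookup_add lookup_single when_def)

lemma lookup_list_mon_eq_0: "v \<notin> set vs \<Longrightarrow> Poly_Mapping.lookup (list_mon vs) v = 0"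
  by (simp add: not_in_keys_iff_lookup_eq_zero[symmetric])

text \<open>Every summand either deletes an occurrence of \<open>v\<close>, with coefficient
  \<open>y v = 0\<close>, or keeps one, where \<open>z\<close> vanishes.\<close>

lemma kd_zero_at:
  "v \<in> set vs \<Longrightarrow> y v = 0 \<Longrightarrow> (\<And>ws. v \<in> set ws \<Longrightarrow> z ws = 0) \<Longrightarrow> kd y z vs = 0"
proof (induction vs arbitrary: z)
  case (Cons u vs)
  have "kd y (\<lambda>ws. z (u # ws)) vs = 0"
  proof (cases "v \<in> set vs")
    case True
    then show ?thesis by (intro Cons.IH) (auto intro!: Cons.prems)
  next
    case False
    then have "u = v" using Cons.prems by simp
    then show ?thesis using Cons.prems by simp
  qed
  moreover have "y u * z vs = 0"
    using Cons.prems by (cases "u = v") auto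
  ultimately show ?case by simp
qed simp

text \<open>Exterior product of \<open>\<zeta>\<close> with the indicator one-forms of the elements of a list.\<close>
definition wedge :: "'w list \<Rightarrow> ('w list \<Rightarrow> 'a::comm_ring_1) \<Rightarrow> 'w list \<Rightarrow> 'a" where
  "wedge gs = foldr (\<lambda>g. kd (\<lambda>v. of_bool (v = g))) gs"

lemma wedge_simps [simp]:
  "wedge [] \<zeta> = \<zeta>" "wedge (g # gs) \<zeta> = kd (\<lambda>v. of_bool (v = g)) (wedge gs \<zeta>)"
  by (simp_all add: wedge_def)

lemma wedge_closed:
  assumes "\<And>p q. p \<in> I \<Longrightarrow> q \<in> I \<Longrightarrow> p - q \<in> I" "0 \<in> I"
    and "\<And>ws. set ws \<subseteq> set vs \<Longrightarrow> length ws + length gs = length vs \<Longrightarrow> \<zeta> ws \<in> I"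
  shows "wedge gs \<zeta> vs \<in> I"
  using assms(3)
proof (induction gs arbitrary: vs)
  case (Cons g gs)
  show ?case
    unfolding wedge_simps
  proof (rule kd_closed[OF assms(1,2)])
    show "wedge gs \<zeta> ws \<in> I" if "set ws \<subseteq> set vs" "Suc (length ws) = length vs" for ws
      by (rule Cons.IH) (use that Cons.prems in auto)
  qed (auto simp: assms(2))
qed simp

lemma wedge_scale: "wedge gs (\<lambda>ws. c * \<zeta> ws) vs = c * wedge gs \<zeta> vs"
proof (induction gs arbitrary: vs)
  case (Cons g gs)
  have "wedge gs (\<lambda>ws. c * \<zeta> ws) = (\<lambda>ws. c * wedge gs \<zeta> ws)" using Cons.IH by blast
  then show ?case by (simp add: kd_scale)
qed simp

lemma kd_wedge: "kd y (wedge gs \<zeta>) vs = (- 1) ^ length gs * wedge gs (kd y \<zeta>) vs"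
proof (induction gs arbitrary: vs)
  case (Cons g gs)
  have "kd y (wedge gs \<zeta>) = (\<lambda>ws. (- 1) ^ length gs * wedge gs (kd y \<zeta>) ws)"
    using Cons.IH by blast
  then show ?case
    by (simp add: kd_anticommute[of y] kd_scale)
qed simp

lemma wedge_kd_zero:
  assumes "g \<in> set gs"
  shows "kd (\<lambda>v. of_bool (v = g)) (wedge gs \<zeta>) vs = 0"
  using assms
proof (induction gs arbitrary: vs)
  case (Cons h gs)
  show ?case
  proof (cases "g = h")
    case True
    then show ?thesis by (simp add: kd_kd)
  next
    case False
    then have "kd (\<lambda>v. of_bool (v = g)) (wedge gs \<zeta>) = (\<lambda>_. 0)" using Cons by auto
    then show ?thesis by (simp add: kd_anticommute[of _ "\<lambda>v. of_bool (v = h)"])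
  qed
qed simp

text \<open>Each \<open>g\<close> occurs once in \<open>gs @ bs\<close>, so only the summand
  deleting it from the front survives, with sign +1.\<close>

lemma wedge_append:
  assumes "distinct gs" "set gs \<inter> set bs = {}"
  shows "wedge gs \<zeta> (gs @ bs) = \<zeta> bs"
  using assms
proof (induction gs)
  case (Cons g gs)
  have "kd (\<lambda>v. of_bool (v = g)) (\<lambda>ws. wedge gs \<zeta> (g # ws)) (gs @ bs) = 0"
    by (rule kd_form_zero) (use Cons.prems in auto)
  then show ?case using Cons by simp
qed simp

text \<open>On finely homogeneous cochains the Koszul differential is the simplicial coboundary of
  the coefficients. The offset \<open>a\<close> absorbs the entry that the recursion moves from the
  list into the cochain.\<close>

lemma kd_monomial_cochain:
  fixes \<omega> :: "'w list \<Rightarrow> 'k::field"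
  assumes "\<And>v. v \<in> set vs \<Longrightarrow> y v = var v"
  shows "kd y (\<lambda>ws. Poly_Mapping.single (a + list_mon ws) (\<omega> ws)) vs
    = Poly_Mapping.single (a + list_mon vs) (kd (\<lambda>_. 1) \<omega> vs)"
  using assms
proof (induction vs arbitrary: a \<omega>)
  case (Cons v vs)
  have "kd y (\<lambda>ws. Poly_Mapping.single ((a + Poly_Mapping.single v 1) + list_mon ws) (\<omega> (v # ws))) vs
    = Poly_Mapping.single ((a + Poly_Mapping.single v 1) + list_mon vs) (kd (\<lambda>_. 1) (\<lambda>ws. \<omega> (v # ws)) vs)"
    by (rule Cons.IH) (use Cons.prems in simp)
  then show ?case
    using Cons.prems by (simp add: var_def mult_single single_diff add_ac)
qed simp

text \<open>The converse passage for an arbitrary \<open>w\<close>: its coefficients in the fine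
  degree of the list form a simplicial cochain, and extracting them commutes with the
  differentials.\<close>

lemma lookup_kd_restrict:
  fixes w :: "'w list \<Rightarrow> ('w, 'k::field) mpoly"
  assumes "\<And>v. v \<in> set bs \<Longrightarrow> y v = var v"
  shows "Poly_Mapping.lookup (kd y w bs) (a + list_mon bs)
    = kd (\<lambda>_. 1) (\<lambda>bs. Poly_Mapping.lookup (w bs) (a + list_mon bs)) bs"
  using assms
proof (induction bs arbitrary: a w)
  case (Cons b bs)
  have "Poly_Mapping.lookup (kd y (\<lambda>ws. w (b # ws)) bs) ((a + Poly_Mapping.single b 1) + list_mon bs)
    = kd (\<lambda>_. 1) (\<lambda>bs. Poly_Mapping.lookup (w (b # bs)) ((a + Poly_Mapping.single b 1) + list_mon bs)) bs"
    by (rule Cons.IH) (use Cons.prems in simp)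
  moreover have "Poly_Mapping.lookup (var b * w bs) (Poly_Mapping.single b 1 + (a + list_mon bs))
    = Poly_Mapping.lookup (w bs) (a + list_mon bs)"
    unfolding var_def by (simp add: lookup_single_mult_add)
  ultimately show ?case
    using Cons.prems by (simp add: lookup_minus add_ac)
qed simp

lemma var_power2: "var g ^ 2 = (Poly_Mapping.single (Poly_Mapping.single g 2) 1 :: ('w, 'k::field) mpoly)"
  by (simp add: var_def power2_eq_square mult_single numeral_2_eq_2 flip: single_add)

text \<open>A summand deleting some \<open>g\<close> of \<open>gs\<close> carries
  \<open>var g ^ 2\<close> and cannot contribute to a monomial with exponent below 2 at
  \<open>g\<close>. Only deletions from \<open>bs\<close> remain, with the sign of the positions
  skipped.\<close>

lemma lookup_kd_append:
  fixes w :: "'w list \<Rightarrow> ('w, 'k::field) mpoly"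
  assumes "\<And>g. g \<in> set gs \<Longrightarrow> y g = var g ^ 2 \<and> Poly_Mapping.lookup M g < 2"
  shows "Poly_Mapping.lookup (kd y w (gs @ bs)) M
    = (- 1) ^ length gs * Poly_Mapping.lookup (kd y (\<lambda>ws. w (gs @ ws)) bs) M"
  using assms
proof (induction gs arbitrary: w)
  case (Cons g gs)
  have "Poly_Mapping.lookup (var g ^ 2 * w (gs @ bs)) M = 0"
  proof (rule ccontr)
    assume "Poly_Mapping.lookup (var g ^ 2 * w (gs @ bs)) M \<noteq> 0"
    then have "M \<in> Poly_Mapping.keys (var g ^ 2 * w (gs @ bs))" by (simp add: in_keys_iff)
    then obtain b where "M = Poly_Mapping.single g 2 + b"
      using keys_single_mult[of "Poly_Mapping.single g 2" 1 "w (gs @ bs)"] by (auto simp: var_power2)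
    then show False using Cons.prems[of g] by (simp add: lookup_add)
  qed
  moreover have "Poly_Mapping.lookup (kd y (\<lambda>ws. w (g # ws)) (gs @ bs)) M
    = (- 1) ^ length gs * Poly_Mapping.lookup (kd y (\<lambda>ws. w (g # gs @ ws)) bs) M"
    by (rule Cons.IH) (use Cons.prems in simp)
  ultimately show ?case
    using Cons.prems[of g] by (simp add: lookup_minus)
qed simp

text \<open>One half of Hochster's formula. A cocycle \<open>\<omega>\<close> of the link of \<open>G\<close> yields a Koszul cocycle
  with coefficients \<open>x\<^sub>G x\<^sub>A\<close> on the sets \<open>G \<union> A\<close>; taking squares of the variables in \<open>G\<close>
  keeps the factor \<open>x\<^sub>G\<close> from being absorbed into a coboundary.\<close>
lemma depth_face_ideal_le:
  fixes V :: "'w set"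
  assumes cl: "subset_closed \<Delta>" and sub: "\<Union>\<Delta> \<subseteq> V" and G: "finite G" "G \<subseteq> V"
    and nac: "\<not> acyclic_at TYPE('k::field) {A. A \<inter> G = {} \<and> A \<union> G \<in> \<Delta>} p"
  shows "depth V (face_ideal V \<Delta> :: ('w, 'k) mpoly set) \<le> enat (card G + p)"
  unfolding depth_def
proof (intro SUP_least)
  let ?J = "face_ideal V \<Delta> :: ('w, 'k) mpoly set"
  let ?L = "{A. A \<inter> G = {} \<and> A \<union> G \<in> \<Delta>}"
  fix fs assume "fs \<in> {fs. regular_seq V ?J fs}"
  then have reg: "set fs \<subseteq> gen_ideal (polys V) (var ` V)"
    "\<And>i g. i < length fs \<Longrightarrow> g \<in> polys V \<Longrightarrow>
        fs ! i * g \<in> gen_ideal (polys V) (?J \<union> set (take i fs)) \<Longrightarrow>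
        g \<in> gen_ideal (polys V) (?J \<union> set (take i fs))"
    unfolding regular_seq_def by auto
  have J: "ideal_of (polys V) ?J" by (rule ideal_face_ideal[OF cl])
  show "enat (length fs) \<le> enat (card G + p)"
  proof (rule ccontr)
    assume "\<not> enat (length fs) \<le> enat (card G + p)"
    then have long: "card G + p < length fs" by simp
    obtain gs where gs: "distinct gs" "set gs = G" using G(1) finite_distinct_list by blast
    then have len: "length gs = card G" using distinct_card by fastforce
    obtain \<omega> :: "'w list \<Rightarrow> 'k"
      where \<omega>: "\<And>vs. length vs = Suc p \<Longrightarrow> set vs \<in> ?L \<Longrightarrow> kd (\<lambda>_. 1) \<omega> vs = 0"
      and n\<omega>: "\<And>w. \<exists>vs. length vs = p \<and> set vs \<in> ?L \<and> \<omega> vs \<noteq> kd (\<lambda>_. 1) w vs"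
      by (rule not_acyclic_atE[OF nac]) blast
    define e where "e = (\<lambda>v. if v \<in> G then 2 else 1 :: nat)"
    define y where "y = (\<lambda>v. var v ^ e v :: ('w, 'k) mpoly)"
    \<comment> \<open>\<open>y\<close> splits into \<open>y'\<close> and multiples of the indicator
      forms of \<open>G\<close>; the latter annihilate \<open>wedge gs z0\<close>, so only
      \<open>y'\<close> matters.\<close>
    define y' where "y' = (\<lambda>v. if v \<in> G then 0 else var v :: ('w, 'k) mpoly)"
    \<comment> \<open>Zero on lists meeting \<open>G\<close>: together with \<open>y' = 0\<close> on
      \<open>G\<close> this makes \<open>kd y' z0\<close> vanish on them. Zero off \<open>V\<close>
      keeps the values in \<open>polys V\<close>.\<close>
    define z0 where "z0 = (\<lambda>ws. if set ws \<inter> G = {} \<and> set ws \<subseteq> V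
      then Poly_Mapping.single (list_mon ws) (\<omega> ws) else 0)"
    \<comment> \<open>Multiplication by this monomial sends terms whose support is not in the link
      of \<open>G\<close> into the ideal, so it suffices that \<open>\<omega>\<close> is a cocycle
      on the link.\<close>
    define xG where "xG = (Poly_Mapping.single (list_mon gs) 1 :: ('w, 'k) mpoly)"
    define z where "z = (\<lambda>vs. xG * wedge gs z0 vs)"
    have y_eq: "y = (\<lambda>v. y' v + (\<Sum>g\<in>G. var g ^ 2 * of_bool (v = g)))"
      by (rule ext) (auto simp: y_def y'_def e_def G(1))
    have zR: "z vs \<in> polys V" for vs
    proof -
      have "wedge gs z0 vs \<in> polys V"
        by (rule wedge_closed) (auto simp: z0_def)
      then show ?thesis using G gs unfolding z_def xG_def by simp
    qed
    have z0_cocycle: "xG * kd y' z0 ws \<in> ?J" if ws: "length ws = Suc p" "set ws \<subseteq> V" for ws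
    proof (cases "set ws \<inter> G = {}")
      case True
      have "kd y' z0 ws = kd y' (\<lambda>ws. Poly_Mapping.single (0 + list_mon ws) (\<omega> ws)) ws"
        by (rule kd_cong) (use True ws in \<open>auto simp: z0_def\<close>)
      also have "\<dots> = Poly_Mapping.single (0 + list_mon ws) (kd (\<lambda>_. 1) \<omega> ws)"
        by (rule kd_monomial_cochain) (use True in \<open>auto simp: y'_def\<close>)
      finally have eq: "xG * kd y' z0 ws
          = Poly_Mapping.single (list_mon gs + list_mon ws) (kd (\<lambda>_. 1) \<omega> ws)"
        by (simp add: xG_def mult_single)
      show ?thesis
      proof (cases "set ws \<union> G \<in> \<Delta>")
        case face: True
        then show ?thesis
          using \<omega>[OF ws(1)] True eq ideal_ofD(2)[OF J] by simp
      next
        case False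
        then show ?thesis
          using ws G gs eq unfolding face_ideal_def by (auto simp: keys_add_nat Un_commute)
      qed
    next
      case False
      then obtain g where "g \<in> set ws" "g \<in> G" by blast
      then have "kd y' z0 ws = 0"
        by (intro kd_zero_at[of g]) (auto simp: y'_def z0_def)
      then show ?thesis using ideal_ofD(2)[OF J] by simp
    qed
    have z_cocycle: "kd y z vs \<in> ?J" if vs: "length vs = Suc (card G + p)" "set vs \<subseteq> V" for vs
    proof -
      have "kd y (wedge gs z0) vs
          = kd y' (wedge gs z0) vs + (\<Sum>g\<in>G. var g ^ 2 * kd (\<lambda>v. of_bool (v = g)) (wedge gs z0) vs)"
        unfolding y_eq kd_form_add kd_form_sum kd_form_scale by simp
      also have "\<dots> = (- 1) ^ length gs * wedge gs (kd y' z0) vs"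
        by (simp add: wedge_kd_zero gs kd_wedge[of y'])
      finally have "kd y z vs = (- 1) ^ length gs * wedge gs (\<lambda>ws. xG * kd y' z0 ws) vs"
        unfolding z_def kd_scale wedge_scale by (simp add: mult.left_commute)
      moreover have "wedge gs (\<lambda>ws. xG * kd y' z0 ws) vs \<in> ?J"
        by (rule wedge_closed) (use vs len in \<open>auto intro!: ideal_ofD[OF J] z0_cocycle\<close>)
      ultimately show ?thesis
        using ideal_ofD(5)[OF J] by simp
    qed
    obtain w where w: "\<And>vs. length vs = card G + p \<Longrightarrow> set vs \<subseteq> V \<Longrightarrow> z vs - kd y w vs \<in> ?J"
    proof -
      have "\<exists>w. (\<forall>vs. w vs \<in> polys V) \<and>
          (\<forall>vs. length vs = card G + p \<longrightarrow> set vs \<subseteq> V \<longrightarrow> z vs - kd y w vs \<in> ?J)"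
        unfolding y_def
      proof (rule koszul_vanishing[OF J reg(1) _ long])
        show "z vs \<in> polys V" for vs by (rule zR)
      qed (use reg(2) z_cocycle y_def in auto)
      then show thesis using that by blast
    qed
    \<comment> \<open>The coefficient of \<open>w\<close> in the fine degree of
      \<open>gs @ bs\<close>, with the sign from moving past \<open>gs\<close>. Where
      \<open>G\<close> and \<open>bs\<close> form a face, the ideal has no term in that degree, so
      \<open>\<omega>\<close> is compared with a coboundary exactly.\<close>
    define \<phi> where "\<phi> = (\<lambda>bs. (- 1) ^ length gs * Poly_Mapping.lookup (w (gs @ bs)) (list_mon gs + list_mon bs))"
    have "\<omega> bs = kd (\<lambda>_. 1) \<phi> bs" if bs: "length bs = p" "set bs \<in> ?L" for bs
    proof -
      let ?M = "list_mon gs + list_mon bs"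
      have bsV: "set bs \<subseteq> V" using bs sub by blast
      have disj: "set gs \<inter> set bs = {}" using bs gs by auto
      have "z (gs @ bs) = Poly_Mapping.single ?M (\<omega> bs)"
        unfolding z_def wedge_append[OF gs(1) disj]
        using bs bsV by (simp add: z0_def xG_def mult_single)
      moreover have "Poly_Mapping.lookup (z (gs @ bs) - kd y w (gs @ bs)) ?M = 0"
      proof (rule lookup_face_ideal)
        show "z (gs @ bs) - kd y w (gs @ bs) \<in> ?J"
          by (rule w) (use bs bsV gs G len in auto)
        show "Poly_Mapping.keys ?M \<in> \<Delta>" using bs gs by (simp add: keys_add_nat Un_commute)
      qed
      ultimately have "\<omega> bs = Poly_Mapping.lookup (kd y w (gs @ bs)) ?M"
        by (simp add: lookup_minus)
      also have "\<dots> = (- 1) ^ length gs * Poly_Mapping.lookup (kd y (\<lambda>ws. w (gs @ ws)) bs) ?M"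
      proof (rule lookup_kd_append)
        fix g assume g: "g \<in> set gs"
        then have "Poly_Mapping.lookup (list_mon gs) g = 1" "Poly_Mapping.lookup (list_mon bs) g = 0"
          using gs(1) disj by (auto simp: lookup_list_mon_distinct intro!: lookup_list_mon_eq_0)
        then show "y g = var g ^ 2 \<and> Poly_Mapping.lookup ?M g < 2"
          using g gs by (simp add: y_def e_def lookup_add)
      qed
      also have "\<dots> = kd (\<lambda>_. 1) \<phi> bs"
        unfolding \<phi>_def kd_scale
        by (subst lookup_kd_restrict) (use disj gs in \<open>auto simp: y_def e_def\<close>)
      finally show ?thesis .
    qed
    then show False using n\<omega>[of \<phi>] by blast
  qed
qed

section \<open>A lower bound for the Stanley depth\<close>

definition sqfree :: "'w set \<Rightarrow> 'w \<Rightarrow>\<^sub>0 nat" where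
  "sqfree B = (\<Sum>v\<in>B. Poly_Mapping.single v 1)"

lemma lookup_sqfree: "finite B \<Longrightarrow> Poly_Mapping.lookup (sqfree B) v = (if v \<in> B then 1 else 0)"
  by (simp add: sqfree_def lookup_sum lookup_single when_def)

lemma keys_sqfree: "finite B \<Longrightarrow> Poly_Mapping.keys (sqfree B) = B"
  by (auto simp: in_keys_iff lookup_sqfree split: if_splits)

lemma keys_minus_subset: "Poly_Mapping.keys (m - a) \<subseteq> Poly_Mapping.keys (m :: 'w \<Rightarrow>\<^sub>0 nat)"
  by (auto simp: in_keys_iff lookup_minus)

lemma sqfree_add_minus:
  assumes "B \<subseteq> Poly_Mapping.keys m"
  shows "sqfree B + (m - sqfree B) = m"
proof (rule poly_mapping_eqI)
  fix v
  have "v \<in> B \<Longrightarrow> Poly_Mapping.lookup m v \<noteq> 0"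
    using assms by (auto simp: in_keys_iff)
  then show "Poly_Mapping.lookup (sqfree B + (m - sqfree B)) v = Poly_Mapping.lookup m v"
    using finite_subset[OF assms] by (simp add: lookup_add lookup_minus lookup_sqfree)
qed

text \<open>A partition of the face poset into intervals is a Stanley decomposition: the space with
  generator \<open>sqfree (lo A)\<close> and variables \<open>hi A\<close> is spanned by the
  monomials with support in the interval. Encoding the partition by functions constant on intervals
  lets a monomial name its piece through its support.\<close>

lemma sdepth_face_ideal_ge:
  fixes V :: "'w set" and lo hi :: "'w set \<Rightarrow> 'w set"
  assumes V: "finite V" and cl: "subset_closed \<Delta>" and sub: "\<Union>\<Delta> \<subseteq> V"
    and interval: "\<And>A. A \<in> \<Delta> \<Longrightarrow> lo A \<subseteq> A \<and> A \<subseteq> hi A \<and> hi A \<in> \<Delta>"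
    and const: "\<And>A A'. A \<in> \<Delta> \<Longrightarrow> lo A \<subseteq> A' \<Longrightarrow> A' \<subseteq> hi A \<Longrightarrow> lo A' = lo A \<and> hi A' = hi A"
    and card: "\<And>A. A \<in> \<Delta> \<Longrightarrow> s \<le> card (hi A)"
  shows "enat s \<le> sdepth V (face_ideal V \<Delta> :: ('w, 'k::field) mpoly set)"
proof -
  let ?J = "face_ideal V \<Delta> :: ('w, 'k) mpoly set"
  have J: "ideal_of (polys V) ?J" by (rule ideal_face_ideal[OF cl])
  have sub': "A \<subseteq> V" "lo A \<subseteq> V" "hi A \<subseteq> V" if "A \<in> \<Delta>" for A
    using interval[OF that] sub that by blast+
  define c :: "'w set \<Rightarrow> ('w, 'k) mpoly \<times> 'w set"
    where "c A = (Poly_Mapping.single (sqfree (lo A)) 1, hi A)" for A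
  define D where "D = c ` \<Delta>"
  have finD: "finite D"
    unfolding D_def using finite_subset[of \<Delta> "Pow V"] V sub by auto
  have piece: "Poly_Mapping.keys m \<in> \<Delta> \<and> c (Poly_Mapping.keys m) = d"
    if d: "d \<in> D" and f: "f \<in> polys (snd d)" and m: "m \<in> Poly_Mapping.keys (fst d * f)" for d f m
  proof -
    obtain A where A: "A \<in> \<Delta>" "d = c A" using d unfolding D_def by blast
    obtain b where b: "b \<in> Poly_Mapping.keys f" "m = sqfree (lo A) + b"
      using m keys_single_mult[of "sqfree (lo A)" 1 f] A unfolding c_def by auto
    have "Poly_Mapping.keys b \<subseteq> hi A" using b f A unfolding polys_def c_def by auto
    then have k: "lo A \<subseteq> Poly_Mapping.keys m" "Poly_Mapping.keys m \<subseteq> hi A"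
      using b interval[OF A(1)] keys_sqfree[OF finite_subset[OF sub'(2)[OF A(1)] V]] by (auto simp: keys_add_nat)
    then show ?thesis
      using const[OF A(1) k] A interval[OF A(1)] cl unfolding c_def subset_closed_def by auto
  qed
  have "stanley_decomposition V ?J D"
    unfolding stanley_decomposition_def
  proof (intro conjI allI impI ballI)
    show "finite D" by (rule finD)
  next
    fix d assume "d \<in> D"
    then obtain A where A: "A \<in> \<Delta>" "d = c A" unfolding D_def by blast
    have "f = 0" if f: "f \<in> polys (hi A)" and uf: "Poly_Mapping.single (sqfree (lo A)) 1 * f \<in> ?J" for f
    proof (rule poly_mapping_eqI)
      fix b
      show "Poly_Mapping.lookup f b = Poly_Mapping.lookup 0 b"
      proof (cases "b \<in> Poly_Mapping.keys f")
        case True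
        then have "sqfree (lo A) + b \<in> Poly_Mapping.keys (fst d * f)"
          by (simp add: A(2) c_def in_keys_iff lookup_single_mult_add)
        then have "Poly_Mapping.keys (sqfree (lo A) + b) \<in> \<Delta>"
          using piece[of d f] \<open>d \<in> D\<close> f A unfolding c_def by simp
        then show ?thesis
          using lookup_face_ideal[OF uf, of "sqfree (lo A) + b"] by (simp add: lookup_single_mult_add)
      qed (simp add: in_keys_iff)
    qed
    then show "case d of (u, Z) \<Rightarrow> u \<in> polys V \<and> (\<exists>c m. u = Poly_Mapping.single m c) \<and> Z \<subseteq> V \<and>
        (\<forall>f\<in>polys Z. u * f \<in> ?J \<longrightarrow> f = 0)"
      using A(2) sub'[OF A(1)] keys_sqfree[OF finite_subset[OF sub'(2)[OF A(1)] V]] unfolding c_def by auto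
  next
    fix p :: "('w, 'k) mpoly" assume p: "p \<in> polys V"
    \<comment> \<open>The terms of \<open>p\<close> with face support are sorted by piece and
      divided by its generator; all other terms lie in the ideal.\<close>
    define K where "K = {m \<in> Poly_Mapping.keys p. Poly_Mapping.keys m \<in> \<Delta>}"
    define f where "f d = (\<Sum>m\<in>{m \<in> K. c (Poly_Mapping.keys m) = d}.
      Poly_Mapping.single (m - sqfree (lo (Poly_Mapping.keys m))) (Poly_Mapping.lookup p m))" for d
    have finK: "finite K" unfolding K_def by simp
    have "f d \<in> polys (snd d)" if "d \<in> D" for d
    proof -
      have "Poly_Mapping.keys (m - sqfree (lo (Poly_Mapping.keys m))) \<subseteq> snd d"
        if "m \<in> K" "c (Poly_Mapping.keys m) = d" for m
      proof -
        have "Poly_Mapping.keys m \<subseteq> snd d" using that interval[of "Poly_Mapping.keys m"] unfolding K_def c_def by auto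
        then show ?thesis by (rule order_trans[OF keys_minus_subset])
      qed
      then show ?thesis unfolding f_def by (auto intro!: polys_sum)
    qed
    moreover have "p - (\<Sum>d\<in>D. fst d * f d) \<in> ?J"
    proof -
      have "fst d * f d = (\<Sum>m\<in>{m \<in> K. c (Poly_Mapping.keys m) = d}.
          Poly_Mapping.single m (Poly_Mapping.lookup p m))" for d
        unfolding f_def sum_distrib_left
      proof (rule sum.cong[OF refl])
        fix m assume m: "m \<in> {m \<in> K. c (Poly_Mapping.keys m) = d}"
        let ?A = "Poly_Mapping.keys m"
        have A: "?A \<in> \<Delta>" using m unfolding K_def by simp
        have "sqfree (lo ?A) + (m - sqfree (lo ?A)) = m"
          using interval[OF A] by (intro sqfree_add_minus) simp
        then show "fst d * Poly_Mapping.single (m - sqfree (lo ?A)) (Poly_Mapping.lookup p m)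
            = Poly_Mapping.single m (Poly_Mapping.lookup p m)"
          using m by (auto simp: c_def mult_single)
      qed
      then have "(\<Sum>d\<in>D. fst d * f d) = (\<Sum>d\<in>D. \<Sum>m\<in>{m \<in> K. c (Poly_Mapping.keys m) = d}.
          Poly_Mapping.single m (Poly_Mapping.lookup p m))" by simp
      also have "\<dots> = (\<Sum>m\<in>K. Poly_Mapping.single m (Poly_Mapping.lookup p m))"
        by (rule sum.group[OF finK finD]) (auto simp: K_def D_def)
      finally have eq: "(\<Sum>d\<in>D. fst d * f d) = (\<Sum>m\<in>K. Poly_Mapping.single m (Poly_Mapping.lookup p m))" .
      have "(\<Sum>m\<in>K. Poly_Mapping.single m (Poly_Mapping.lookup p m)) \<in> polys V"
        using p unfolding K_def polys_def[of V] by (intro polys_sum[of _ _ V, unfolded polys_def[of V]]) auto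
      moreover have "Poly_Mapping.keys m \<notin> \<Delta>"
        if "m \<in> Poly_Mapping.keys (p - (\<Sum>m\<in>K. Poly_Mapping.single m (Poly_Mapping.lookup p m)))" for m
      proof
        assume "Poly_Mapping.keys m \<in> \<Delta>"
        then have "Poly_Mapping.lookup (p - (\<Sum>m\<in>K. Poly_Mapping.single m (Poly_Mapping.lookup p m))) m = 0"
          using finK by (auto simp: lookup_minus lookup_sum lookup_single when_def K_def in_keys_iff)
        then show False using that by (simp add: in_keys_iff)
      qed
      ultimately show ?thesis unfolding eq face_ideal_def using p by simp
    qed
    ultimately show "\<exists>f. (\<forall>d\<in>D. f d \<in> polys (snd d)) \<and> p - (\<Sum>d\<in>D. fst d * f d) \<in> ?J"
      by blast
  next
    fix f d
    assume f: "(\<forall>d\<in>D. f d \<in> polys (snd d)) \<and> (\<Sum>d\<in>D. fst d * f d) \<in> ?J" and d: "d \<in> D"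
    \<comment> \<open>A term of one piece occurs in no other and has face support, so it would
      survive in the sum; hence each summand is even 0.\<close>
    have "Poly_Mapping.keys (fst d * f d) = {}"
    proof (rule ccontr)
      assume "Poly_Mapping.keys (fst d * f d) \<noteq> {}"
      then obtain m where m: "m \<in> Poly_Mapping.keys (fst d * f d)" by blast
      then have face: "Poly_Mapping.keys m \<in> \<Delta>" "c (Poly_Mapping.keys m) = d"
        using piece[OF d _ m] f d by auto
      have "Poly_Mapping.lookup (fst d' * f d') m = 0" if "d' \<in> D - {d}" for d'
      proof (rule ccontr)
        assume "Poly_Mapping.lookup (fst d' * f d') m \<noteq> 0"
        then have "m \<in> Poly_Mapping.keys (fst d' * f d')" by (simp add: in_keys_iff)
        then show False using piece[of d' "f d'" m] f that face(2) by auto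
      qed
      then have "Poly_Mapping.lookup (\<Sum>d\<in>D. fst d * f d) m = Poly_Mapping.lookup (fst d * f d) m"
        unfolding lookup_sum by (subst sum.remove[OF finD d]) simp
      then show False
        using lookup_face_ideal[OF conjunct2[OF f] face(1)] m by (simp add: in_keys_iff)
    qed
    then show "fst d * f d \<in> ?J" using ideal_ofD(2)[OF J] by simp
  qed
  moreover have "enat s \<le> (INF d\<in>D. enat (card (snd d)))"
    using card by (auto intro!: INF_greatest simp: D_def c_def)
  ultimately show ?thesis
    unfolding sdepth_def by (intro SUP_upper2[of D]) auto
qed

lemma mem_gen_complex_set: "A \<in> gen_complex (set Fs) \<longleftrightarrow> (\<exists>l<length Fs. A \<subseteq> Fs ! l)"
  unfolding gen_complex_def mem_Collect_eq by (metis in_set_conv_nth)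

section \<open>The interval partition of a block shelling\<close>

context block_shelling
begin

text \<open>Every block \<open>B\<close> met by \<open>A\<close> contributes to the interval of \<open>A\<close> its least vertex in \<open>A\<close>;
  this is the decomposition of the maximal ideal of \<open>K[B]\<close> into the spaces
  \<open>x\<^sub>v K[w \<in> B. v \<le> w]\<close>.\<close>
lemma sdepth_ge:
  assumes V: "finite V" and sub: "\<Union>(set Fs) \<subseteq> V"
    and s: "\<And>j. j < length Fs \<Longrightarrow> s \<le> card (core j) + card (Q j)"
  shows "enat s \<le> sdepth V (face_ideal V (gen_complex (set Fs)) :: ('w, 'k::field) mpoly set)"
proof -
  obtain f :: "'w \<Rightarrow> nat" and n where f: "inj_on f V"
    using finite_imp_inj_to_nat_seg[OF V] by blast
  define fj where "fj A = (LEAST l. A \<subseteq> Fs ! l)" for A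
  define lo where "lo A = {v \<in> A. \<exists>B\<in>Q (fj A). v \<in> B \<and> (\<forall>w\<in>A \<inter> B. f v \<le> f w)}" for A
  \<comment> \<open>Vertices of the core lie in no block, satisfy the condition vacuously and are
    therefore free in every interval.\<close>
  define hi where "hi A = {w \<in> Fs ! fj A. \<forall>B\<in>Q (fj A). w \<in> B \<longrightarrow> (\<exists>v\<in>A \<inter> B. f v \<le> f w)}" for A
  note mem = mem_gen_complex_set
  have first: "fj A < length Fs" "A \<subseteq> Fs ! fj A" "\<And>B. B \<in> Q (fj A) \<Longrightarrow> A \<inter> B \<noteq> {}"
    if A: "A \<in> gen_complex (set Fs)" for A
  proof -
    obtain l where l: "l < length Fs" "A \<subseteq> Fs ! l" using A mem[of A] by blast
    then show 1: "fj A < length Fs" unfolding fj_def using Least_le[of "\<lambda>l. A \<subseteq> Fs ! l" l] by linarith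
    show 2: "A \<subseteq> Fs ! fj A" unfolding fj_def by (rule LeastI[of "\<lambda>l. A \<subseteq> Fs ! l", OF l(2)])
    have "\<not> (\<exists>l<fj A. A \<subseteq> Fs ! l)" unfolding fj_def using not_less_Least by blast
    then show "A \<inter> B \<noteq> {}" if "B \<in> Q (fj A)" for B
      using shell[OF 1 2] that by blast
  qed
  have least: "\<exists>v\<in>A \<inter> B. v \<in> lo A \<and> (\<forall>w\<in>A \<inter> B. f v \<le> f w)"
    if A: "A \<in> gen_complex (set Fs)" "B \<in> Q (fj A)" for A B
  proof -
    obtain u where "u \<in> A \<inter> B" using first(3)[OF A] by blast
    then obtain v where "v \<in> A \<inter> B" "\<forall>w. w \<in> A \<inter> B \<longrightarrow> f v \<le> f w"
      using ex_has_least_nat[of "\<lambda>v. v \<in> A \<inter> B" u f] by blast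
    then show ?thesis using A(2) unfolding lo_def by blast
  qed
  show ?thesis
  proof (rule sdepth_face_ideal_ge[OF V, of _ lo hi])
    show "subset_closed (gen_complex (set Fs))" unfolding subset_closed_def gen_complex_def by blast
    show "\<Union>(gen_complex (set Fs)) \<subseteq> V" using sub unfolding gen_complex_def by blast
  next
    fix A assume A: "A \<in> gen_complex (set Fs)"
    show "lo A \<subseteq> A \<and> A \<subseteq> hi A \<and> hi A \<in> gen_complex (set Fs)"
    proof (intro conjI)
      show "A \<subseteq> hi A" using first(2)[OF A] unfolding hi_def by blast
      show "hi A \<in> gen_complex (set Fs)" using first(1)[OF A] unfolding mem hi_def by blast
    qed (auto simp: lo_def)
    define g where "g B = (SOME v. v \<in> A \<inter> B)" for B
    have g: "g B \<in> A \<inter> B" if "B \<in> Q (fj A)" for B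
      unfolding g_def by (rule someI_ex) (use first(3)[OF A that] in blast)
    have "g ` Q (fj A) \<subseteq> hi A"
    proof -
      have "g B \<in> hi A" if "B \<in> Q (fj A)" for B
        using g[OF that] first(2)[OF A] unfolding hi_def by auto
      then show ?thesis by blast
    qed
    moreover have "core (fj A) \<subseteq> hi A" unfolding core_def hi_def by blast
    moreover have "core (fj A) \<inter> g ` Q (fj A) = {}"
      using g unfolding core_def by blast
    moreover have "card (g ` Q (fj A)) = card (Q (fj A))"
    proof (rule card_image, rule inj_onI)
      fix B B' assume B: "B \<in> Q (fj A)" "B' \<in> Q (fj A)" "g B = g B'"
      then show "B = B'" using disjoint[OF first(1)[OF A] B(1,2)] g by (metis IntE disjoint_iff)
    qed
    moreover have fin: "finite (Fs ! fj A)" using facet[OF first(1)[OF A]] by simp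
    then have "finite (hi A)" "finite (core (fj A))" unfolding hi_def core_def by auto
    ultimately have "card (core (fj A)) + card (Q (fj A)) \<le> card (hi A)"
      using finite_blocks[OF first(1)[OF A]] card_mono[of "hi A" "core (fj A) \<union> g ` Q (fj A)"]
      by (simp add: card_Un_disjoint)
    then show "s \<le> card (hi A)" using s[OF first(1)[OF A]] by linarith
  next
    fix A A' assume A: "A \<in> gen_complex (set Fs)" and A': "lo A \<subseteq> A'" "A' \<subseteq> hi A"
    have sub': "A' \<subseteq> Fs ! fj A" using A' unfolding hi_def by blast
    \<comment> \<open>\<open>A'\<close> contains the least vertex of \<open>A\<close> in each block,
      so it meets every block and has the same first facet. \<open>hi A\<close> admits no smaller
      vertex in a block, so the least vertices agree as well.\<close>
    have "A' \<inter> B \<noteq> {}" if "B \<in> Q (fj A)" for B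
      using least[OF A that] A' by blast
    then have "\<not> (\<exists>l<fj A. A' \<subseteq> Fs ! l)"
      using shell[OF first(1)[OF A] sub'] by blast
    then have fj: "fj A' = fj A"
      unfolding fj_def[of A'] by (intro Least_equality) (use sub' in \<open>auto simp: not_less[symmetric]\<close>)
    have up: "\<exists>v\<in>A \<inter> B. f v \<le> f w" if "B \<in> Q (fj A)" "w \<in> A' \<inter> B" for w B
      using that A' unfolding hi_def by blast
    have down: "\<exists>v\<in>A' \<inter> B. f v \<le> f w" if "B \<in> Q (fj A)" "w \<in> A \<inter> B" for w B
      using least[OF A that(1)] that A' by blast
    have "hi A' = hi A"
    proof -
      have "(\<exists>v\<in>A' \<inter> B. f v \<le> f w) \<longleftrightarrow> (\<exists>v\<in>A \<inter> B. f v \<le> f w)" if "B \<in> Q (fj A)" for B w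
        using up[OF that] down[OF that] le_trans by metis
      then show ?thesis unfolding hi_def fj by auto
    qed
    moreover have "v \<in> lo A" if v: "v \<in> lo A'" for v
    proof -
      obtain B where B: "B \<in> Q (fj A)" "v \<in> A' \<inter> B" "\<forall>w\<in>A' \<inter> B. f v \<le> f w"
        using v unfolding lo_def fj by blast
      obtain v0 where v0: "v0 \<in> A \<inter> B" "v0 \<in> lo A" "\<forall>w\<in>A \<inter> B. f v0 \<le> f w"
        using least[OF A B(1)] by blast
      have "f v = f v0"
      proof (rule antisym)
        show "f v \<le> f v0" using B(3) v0(1,2) A'(1) by blast
        obtain u where "u \<in> A \<inter> B" "f u \<le> f v" using up[OF B(1,2)] by blast
        then show "f v0 \<le> f v" using v0(3) le_trans by blast
      qed
      moreover have "Fs ! fj A \<subseteq> V" using sub first(1)[OF A] nth_mem by blast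
      then have "v \<in> V" "v0 \<in> V" using sub' B(2) v0(1) first(2)[OF A] by auto
      ultimately have "v = v0" using f by (auto dest: inj_onD)
      then show ?thesis using v0 by simp
    qed
    moreover have "v \<in> lo A'" if v: "v \<in> lo A" for v
    proof -
      obtain B where B: "B \<in> Q (fj A)" "v \<in> A \<inter> B" "\<forall>w\<in>A \<inter> B. f v \<le> f w"
        using v unfolding lo_def by blast
      have "f v \<le> f w" if w: "w \<in> A' \<inter> B" for w
      proof -
        obtain u where "u \<in> A \<inter> B" "f u \<le> f w" using up[OF B(1) w] by blast
        then show ?thesis using B(3) le_trans by blast
      qed
      then show ?thesis using B v A'(1) unfolding lo_def fj by blast
    qed
    ultimately show "lo A' = lo A \<and> hi A' = hi A" by blast
  qed
qed

lemma stanley_conjecture: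
  assumes V: "finite V" and sub: "\<Union>(set Fs) \<subseteq> V" and ne: "Fs \<noteq> []"
  shows "stanley_conjecture_holds V (face_ideal V (gen_complex (set Fs)) :: ('w, 'k::field) mpoly set)"
proof -
  let ?\<Delta> = "gen_complex (set Fs)"
  define s where "s j = card (core j) + card (Q j)" for j
  have "0 < length Fs" using ne by simp
  then obtain j where j: "j < length Fs" "\<And>i. i < length Fs \<Longrightarrow> s j \<le> s i"
    using ex_has_least_nat[of "\<lambda>j. j < length Fs" 0 s] by blast
  have core: "core j \<subseteq> Fs ! j" unfolding core_def by blast
  have "{A. A \<inter> core j = {} \<and> A \<union> core j \<in> ?\<Delta>} = link_before (length Fs) (core j)"
    unfolding link_before_def mem_gen_complex_set by simp
  then have "depth V (face_ideal V ?\<Delta> :: ('w, 'k) mpoly set) \<le> enat (s j)"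
    unfolding s_def
  proof (intro depth_face_ideal_le)
    show "subset_closed ?\<Delta>" unfolding subset_closed_def gen_complex_def by blast
    show "\<Union>?\<Delta> \<subseteq> V" using sub unfolding gen_complex_def by blast
    show "finite (core j)" using core facet[OF j(1)] finite_subset by blast
    show "core j \<subseteq> V" using core sub j(1) nth_mem by blast
  qed (use not_acyclic_at_link_core[OF j(1)] in simp)
  also have "enat (s j) \<le> sdepth V (face_ideal V ?\<Delta> :: ('w, 'k) mpoly set)"
    by (rule sdepth_ge[OF V sub]) (use j(2) in \<open>simp add: s_def\<close>)
  finally show ?thesis unfolding stanley_conjecture_holds_def .
qed

end

section \<open>Stanley-Reisner ideals, expansions and shellings\<close>

lemma subset_closed_simplicial_complex: "simplicial_complex X \<Delta> \<Longrightarrow> subset_closed \<Delta>"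
  unfolding simplicial_complex_def subset_closed_def by blast

lemma prod_var: "(\<Prod>x\<in>F. var x) = (Poly_Mapping.single (sqfree F) 1 :: ('w, 'k::field) mpoly)"
  by (induction F rule: infinite_finite_induct) (auto simp: sqfree_def var_def mult_single)

lemma face_ideal_subset_ideal:
  fixes I :: "('w, 'k::field) mpoly set"
  assumes I: "ideal_of (polys V) I"
    and "\<And>m c. Poly_Mapping.keys m \<subseteq> V \<Longrightarrow> Poly_Mapping.keys m \<notin> \<Delta> \<Longrightarrow> Poly_Mapping.single m c \<in> I"
  shows "face_ideal V \<Delta> \<subseteq> I"
proof
  fix p :: "('w, 'k) mpoly"
  assume p: "p \<in> face_ideal V \<Delta>"
  have "(\<Sum>m\<in>Poly_Mapping.keys p. Poly_Mapping.single m (Poly_Mapping.lookup p m)) \<in> I"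
    by (rule ideal_sum[OF I], rule assms(2)) (use p in \<open>auto simp: face_ideal_def polys_def\<close>)
  then show "p \<in> I" using poly_eq_sum_monomials[of p] by simp
qed

lemma SR_ideal_eq_face_ideal:
  assumes "finite X" "simplicial_complex X \<Delta>"
  shows "(SR_ideal X \<Delta> :: ('v, 'k::field) mpoly set) = face_ideal X \<Delta>"
proof
  let ?G = "{(\<Prod>x\<in>F. var x) | F. F \<subseteq> X \<and> F \<notin> \<Delta>} :: ('v, 'k) mpoly set"
  have fin: "finite F" if "F \<subseteq> X" for F using finite_subset[OF that assms(1)] .
  have J: "ideal_of (polys X) (face_ideal X \<Delta> :: ('v, 'k) mpoly set)"
    by (rule ideal_face_ideal[OF subset_closed_simplicial_complex[OF assms(2)]])
  have GJ: "?G \<subseteq> face_ideal X \<Delta>"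
    using fin by (auto simp: prod_var face_ideal_def keys_sqfree)
  then have "?G \<subseteq> polys X" using ideal_ofD(1)[OF J] by blast
  then have I: "ideal_of (polys X) (SR_ideal X \<Delta> :: ('v, 'k) mpoly set)"
    unfolding SR_ideal_def by (rule gen_ideal_ideal)
  show "SR_ideal X \<Delta> \<subseteq> (face_ideal X \<Delta> :: ('v, 'k) mpoly set)"
    unfolding SR_ideal_def by (rule gen_ideal_least[OF J GJ])
  show "face_ideal X \<Delta> \<subseteq> (SR_ideal X \<Delta> :: ('v, 'k) mpoly set)"
  proof (rule face_ideal_subset_ideal[OF I])
    fix m :: "'v \<Rightarrow>\<^sub>0 nat" and c :: 'k
    assume m: "Poly_Mapping.keys m \<subseteq> X" "Poly_Mapping.keys m \<notin> \<Delta>"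
    let ?F = "Poly_Mapping.keys m"
    have "Poly_Mapping.single (m - sqfree ?F) c * (\<Prod>x\<in>?F. var x) \<in> (SR_ideal X \<Delta> :: ('v, 'k) mpoly set)"
      unfolding SR_ideal_def
      by (rule gen_ideal_mem) (use m in \<open>auto intro!: polys_single order_trans[OF keys_minus_subset]\<close>)
    moreover have "Poly_Mapping.single (m - sqfree ?F) c * (\<Prod>x\<in>?F. var x) = Poly_Mapping.single m c"
      using sqfree_add_minus[of ?F m] by (simp add: prod_var mult_single add.commute)
    ultimately show "Poly_Mapping.single m c \<in> (SR_ideal X \<Delta> :: ('v, 'k) mpoly set)" by simp
  qed
qed

text \<open>The squarefree monomial on the support of \<open>u\<close> divides \<open>u\<close> and
  lies in the ideal too, so minimality makes \<open>u\<close> squarefree. In the expansion every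
  power of a \<open>P_ideal\<close> thus has exponent 0 or 1.\<close>

lemma mingens_face_ideal:
  assumes X: "finite X" and u: "u \<in> mingens (face_ideal X \<Delta> :: ('v, 'k::field) mpoly set)"
  shows "Poly_Mapping.keys u \<subseteq> X" "Poly_Mapping.keys u \<notin> \<Delta>" "Poly_Mapping.lookup u x \<le> 1"
proof -
  have mem: "monom v \<in> (face_ideal X \<Delta> :: ('v, 'k) mpoly set) \<longleftrightarrow>
      Poly_Mapping.keys v \<subseteq> X \<and> Poly_Mapping.keys v \<notin> \<Delta>" for v
    by (auto simp: monom_def face_ideal_def polys_def)
  show k: "Poly_Mapping.keys u \<subseteq> X" "Poly_Mapping.keys u \<notin> \<Delta>"
    using u mem unfolding mingens_def by auto
  let ?v = "sqfree (Poly_Mapping.keys u)"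
  have "monom ?v \<in> (face_ideal X \<Delta> :: ('v, 'k) mpoly set)"
    using k mem[of ?v] by (simp add: keys_sqfree)
  moreover have "mon_divides ?v u"
    unfolding mon_divides_def by (auto simp: lookup_sqfree in_keys_iff)
  ultimately have "?v = u" using u unfolding mingens_def by blast
  then show "Poly_Mapping.lookup u x \<le> 1"
    using lookup_sqfree[of "Poly_Mapping.keys u" x] by simp
qed

lemma mingens_face_ideal_exists:
  assumes N: "N \<subseteq> X" "finite N" "N \<notin> \<Delta>"
  shows "\<exists>u\<in>mingens (face_ideal X \<Delta> :: ('v, 'k::field) mpoly set). Poly_Mapping.keys u \<subseteq> N"
proof -
  have mem: "monom v \<in> (face_ideal X \<Delta> :: ('v, 'k) mpoly set) \<longleftrightarrow>
      Poly_Mapping.keys v \<subseteq> X \<and> Poly_Mapping.keys v \<notin> \<Delta>" for v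
    by (auto simp: monom_def face_ideal_def polys_def)
  have fin: "finite {B \<in> Pow N. B \<notin> \<Delta>}" and NN: "N \<in> {B \<in> Pow N. B \<notin> \<Delta>}" using N by auto
  obtain B where B': "B \<in> {B \<in> Pow N. B \<notin> \<Delta>}" "\<forall>C\<in>{B \<in> Pow N. B \<notin> \<Delta>}. C \<subseteq> B \<longrightarrow> B = C"
    using finite_has_minimal2[OF fin NN] by auto
  have B: "B \<subseteq> N" "B \<notin> \<Delta>" using B'(1) by auto
  have Bmin: "C = B" if "C \<notin> \<Delta>" "C \<subseteq> B" for C
    using B'(2) that B(1) by auto
  have finB: "finite B" using B(1) N(2) finite_subset by blast
  have "v = sqfree B" if v: "monom v \<in> (face_ideal X \<Delta> :: ('v, 'k) mpoly set)" "mon_divides v (sqfree B)" for v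
  proof -
    have le: "Poly_Mapping.lookup v x \<le> (if x \<in> B then 1 else 0)" for x
      using v(2) unfolding mon_divides_def lookup_sqfree[OF finB] by (rule spec)
    have "Poly_Mapping.keys v \<subseteq> B"
    proof
      fix x assume "x \<in> Poly_Mapping.keys v"
      then show "x \<in> B" using le[of x] by (auto simp: in_keys_iff split: if_splits)
    qed
    then have keys: "Poly_Mapping.keys v = B" using Bmin v(1) mem by simp
    show ?thesis
    proof (rule poly_mapping_eqI)
      fix x
      have "x \<in> B \<longleftrightarrow> Poly_Mapping.lookup v x \<noteq> 0" unfolding keys[symmetric] by (rule in_keys_iff)
      then show "Poly_Mapping.lookup v x = Poly_Mapping.lookup (sqfree B) x"
        using le[of x] unfolding lookup_sqfree[OF finB] by (auto split: if_splits)
    qed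
  qed
  moreover have "monom (sqfree B) \<in> (face_ideal X \<Delta> :: ('v, 'k) mpoly set)"
    using B(1,2) N(1) mem[of "sqfree B"] by (auto simp: keys_sqfree[OF finB])
  ultimately have "sqfree B \<in> mingens (face_ideal X \<Delta> :: ('v, 'k) mpoly set)"
    unfolding mingens_def by blast
  then show ?thesis using B(1) keys_sqfree[OF finB] by blast
qed

text \<open>The product of the ideals \<open>P_ideal X k i\<close> for \<open>i \<in> A\<close>.\<close>
definition fiber_ideal :: "'v set \<Rightarrow> nat \<Rightarrow> 'v set \<Rightarrow> ('v \<times> nat, 'k::field) mpoly set" where
  "fiber_ideal X k A = face_ideal (exp_vars X k) {B. \<not> A \<subseteq> fst ` B}"

lemma ideal_fiber_ideal: "ideal_of (polys (exp_vars X k)) (fiber_ideal X k A)"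
  unfolding fiber_ideal_def
proof (rule ideal_face_ideal)
  show "subset_closed {B. \<not> A \<subseteq> fst ` B}"
    unfolding subset_closed_def
  proof (intro ballI allI impI CollectI notI)
    fix C D assume "C \<in> {B. \<not> A \<subseteq> fst ` B}" "D \<subseteq> C" "A \<subseteq> fst ` D"
    then show False using image_mono[of D C fst] by auto
  qed
qed

lemma fiber_ideal_empty: "fiber_ideal X k {} = polys (exp_vars X k)"
  unfolding fiber_ideal_def face_ideal_def by simp

lemma P_ideal_eq_fiber_ideal:
  assumes "i \<in> X"
  shows "(P_ideal X k i :: ('v \<times> nat, 'k::field) mpoly set) = fiber_ideal X k {i}"
proof
  let ?G = "{var (i, j) | j. 1 \<le> j \<and> j \<le> k} :: ('v \<times> nat, 'k) mpoly set"
  have G: "?G \<subseteq> fiber_ideal X k {i}"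
    using assms by (auto simp: fiber_ideal_def face_ideal_def exp_vars_def var_def)
  then have "?G \<subseteq> polys (exp_vars X k)" using ideal_ofD(1)[OF ideal_fiber_ideal] by blast
  then have I: "ideal_of (polys (exp_vars X k)) (P_ideal X k i :: ('v \<times> nat, 'k) mpoly set)"
    unfolding P_ideal_def by (rule gen_ideal_ideal)
  show "P_ideal X k i \<subseteq> (fiber_ideal X k {i} :: ('v \<times> nat, 'k) mpoly set)"
    unfolding P_ideal_def by (rule gen_ideal_least[OF ideal_fiber_ideal G])
  show "fiber_ideal X k {i} \<subseteq> (P_ideal X k i :: ('v \<times> nat, 'k) mpoly set)"
    unfolding fiber_ideal_def
  proof (rule face_ideal_subset_ideal[OF I])
    fix m :: "'v \<times> nat \<Rightarrow>\<^sub>0 nat" and c :: 'k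
    assume m: "Poly_Mapping.keys m \<subseteq> exp_vars X k" "Poly_Mapping.keys m \<notin> {B. \<not> {i} \<subseteq> fst ` B}"
    then obtain j where j: "(i, j) \<in> Poly_Mapping.keys m" by auto
    have "Poly_Mapping.single (m - sqfree {(i, j)}) c * var (i, j) \<in> (P_ideal X k i :: ('v \<times> nat, 'k) mpoly set)"
      unfolding P_ideal_def
    proof (rule gen_ideal_mem)
      have "1 \<le> j \<and> j \<le> k" using m(1) j unfolding exp_vars_def by auto
      then show "var (i, j) \<in> ?G" by blast
      show "Poly_Mapping.single (m - sqfree {(i, j)}) c \<in> polys (exp_vars X k)"
        by (rule polys_single, rule order_trans[OF keys_minus_subset m(1)])
    qed
    moreover have "Poly_Mapping.single (m - sqfree {(i, j)}) c * var (i, j) = Poly_Mapping.single m c"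
      using sqfree_add_minus[of "{(i, j)}" m] j
      by (simp add: var_def mult_single sqfree_def add.commute)
    ultimately show "Poly_Mapping.single m c \<in> (P_ideal X k i :: ('v \<times> nat, 'k) mpoly set)" by simp
  qed
qed

text \<open>A monomial meeting all fibres over \<open>A \<union> B\<close> factors into
  \<open>sqfree C\<close>, made of its variables over \<open>A\<close>, and a rest; by disjointness
  the rest keeps every variable over \<open>B\<close>.\<close>

lemma ideal_mult_fiber_ideal:
  assumes "A \<inter> B = {}"
  shows "ideal_mult (polys (exp_vars X k)) (fiber_ideal X k A) (fiber_ideal X k B)
    = (fiber_ideal X k (A \<union> B) :: ('v \<times> nat, 'k::field) mpoly set)"
proof
  let ?R = "polys (exp_vars X k) :: ('v \<times> nat, 'k) mpoly set"
  let ?G = "{a * b | a b. a \<in> fiber_ideal X k A \<and> b \<in> fiber_ideal X k B} :: ('v \<times> nat, 'k) mpoly set"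
  have G: "?G \<subseteq> fiber_ideal X k (A \<union> B)"
  proof
    fix p assume "p \<in> ?G"
    then obtain a b where p: "p = a * b" "a \<in> fiber_ideal X k A" "b \<in> fiber_ideal X k B" by blast
    have "\<not> \<not> A \<union> B \<subseteq> fst ` Poly_Mapping.keys m" if m: "m \<in> Poly_Mapping.keys p" for m
    proof -
      obtain s t where "m = s + t" "s \<in> Poly_Mapping.keys a" "t \<in> Poly_Mapping.keys b"
        using m keys_mult[of a b] p(1) by blast
      then show ?thesis
        using p(2,3) unfolding fiber_ideal_def face_ideal_def
        by (auto simp: keys_add_nat image_Un)
    qed
    then show "p \<in> fiber_ideal X k (A \<union> B)"
      using p unfolding fiber_ideal_def face_ideal_def by auto
  qed
  then have "?G \<subseteq> ?R" using ideal_ofD(1)[OF ideal_fiber_ideal] by blast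
  then have I: "ideal_of ?R (ideal_mult ?R (fiber_ideal X k A) (fiber_ideal X k B))"
    unfolding ideal_mult_def by (rule gen_ideal_ideal)
  show "ideal_mult ?R (fiber_ideal X k A) (fiber_ideal X k B) \<subseteq> fiber_ideal X k (A \<union> B)"
    unfolding ideal_mult_def by (rule gen_ideal_least[OF ideal_fiber_ideal G])
  show "fiber_ideal X k (A \<union> B) \<subseteq> ideal_mult ?R (fiber_ideal X k A) (fiber_ideal X k B)"
    unfolding fiber_ideal_def[of X k "A \<union> B"]
  proof (rule face_ideal_subset_ideal[OF I])
    fix m :: "'v \<times> nat \<Rightarrow>\<^sub>0 nat" and c :: 'k
    assume m: "Poly_Mapping.keys m \<subseteq> exp_vars X k"
      "Poly_Mapping.keys m \<notin> {C. \<not> A \<union> B \<subseteq> fst ` C}"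
    define C where "C = {x \<in> Poly_Mapping.keys m. fst x \<in> A}"
    have C: "finite C" "C \<subseteq> Poly_Mapping.keys m" unfolding C_def by auto
    have kB: "{x \<in> Poly_Mapping.keys m. fst x \<in> B} \<subseteq> Poly_Mapping.keys (m - sqfree C)"
    proof
      fix x assume x: "x \<in> {x \<in> Poly_Mapping.keys m. fst x \<in> B}"
      then have "x \<notin> C" using assms unfolding C_def by auto
      then show "x \<in> Poly_Mapping.keys (m - sqfree C)"
        using x by (simp add: in_keys_iff lookup_minus lookup_sqfree[OF C(1)])
    qed
    have a: "Poly_Mapping.single (sqfree C) 1 \<in> (fiber_ideal X k A :: ('v \<times> nat, 'k) mpoly set)"
    proof -
      have "A \<subseteq> fst ` C" using m(2) unfolding C_def by force
      moreover have "C \<subseteq> exp_vars X k" using C(2) m(1) by blast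
      ultimately show ?thesis
        unfolding fiber_ideal_def face_ideal_def by (simp add: keys_sqfree[OF C(1)])
    qed
    have "B \<subseteq> fst ` Poly_Mapping.keys (m - sqfree C)"
      using kB m(2) by blast
    then have b: "Poly_Mapping.single (m - sqfree C) c \<in> (fiber_ideal X k B :: ('v \<times> nat, 'k) mpoly set)"
      using m(1) unfolding fiber_ideal_def face_ideal_def
      by (auto split: if_splits intro!: polys_single order_trans[OF keys_minus_subset])
    have "1 * (Poly_Mapping.single (sqfree C) 1 * Poly_Mapping.single (m - sqfree C) c)
        \<in> ideal_mult ?R (fiber_ideal X k A) (fiber_ideal X k B)"
      unfolding ideal_mult_def by (rule gen_ideal_mem) (use a b in auto)
    then show "Poly_Mapping.single m c \<in> ideal_mult ?R (fiber_ideal X k A) (fiber_ideal X k B)"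
      by (simp add: mult_single sqfree_add_minus[OF C(2)])
  qed
qed

lemma ideal_power_P_ideal:
  assumes "i \<in> X" "n \<le> 1"
  shows "ideal_power (polys (exp_vars X k)) (P_ideal X k i) n
    = (fiber_ideal X k (if n = 0 then {} else {i}) :: ('v \<times> nat, 'k::field) mpoly set)"
proof (cases "n = 0")
  case True
  then show ?thesis by (simp add: ideal_power_def fiber_ideal_empty)
next
  case False
  then have "n = 1" using assms by simp
  then show ?thesis
    using ideal_mult_fiber_ideal[of "{i}" "{}" X k, where 'k = 'k]
    by (simp add: ideal_power_def P_ideal_eq_fiber_ideal[OF assms(1)] fiber_ideal_empty)
qed

lemma ideal_prod_P_ideal:
  assumes X: "finite X" and u: "Poly_Mapping.keys u \<subseteq> X" "\<And>x. Poly_Mapping.lookup u x \<le> 1"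
  shows "ideal_prod (polys (exp_vars X k))
      (\<lambda>i. ideal_power (polys (exp_vars X k)) (P_ideal X k i) (Poly_Mapping.lookup u i)) X
    = (fiber_ideal X k (Poly_Mapping.keys u) :: ('v \<times> nat, 'k::field) mpoly set)"
proof -
  let ?R = "polys (exp_vars X k) :: ('v \<times> nat, 'k) mpoly set"
  define xs where "xs = (SOME xs. set xs = X \<and> distinct xs)"
  have xs: "set xs = X" "distinct xs"
    using someI_ex[OF finite_distinct_list[OF X]] unfolding xs_def by auto
  \<comment> \<open>\<open>ideal_prod\<close> multiplies along an arbitrarily chosen enumeration of
    \<open>X\<close>, so the claim is made for all distinct lists. Exponent 0 contributes the whole
    ring, the fibre ideal of \<open>{}\<close>.\<close>
  have "foldr (\<lambda>i J. ideal_mult ?R (ideal_power ?R (P_ideal X k i) (Poly_Mapping.lookup u i)) J) ys ?R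
      = fiber_ideal X k (Poly_Mapping.keys u \<inter> set ys)"
    if "set ys \<subseteq> X" "distinct ys" for ys
    using that
  proof (induction ys)
    case Nil
    then show ?case by (simp add: fiber_ideal_empty)
  next
    case (Cons i ys)
    let ?A = "if Poly_Mapping.lookup u i = 0 then {} else {i}"
    have "?A \<inter> (Poly_Mapping.keys u \<inter> set ys) = {}" using Cons.prems by auto
    moreover have "?A \<union> (Poly_Mapping.keys u \<inter> set ys) = Poly_Mapping.keys u \<inter> set (i # ys)"
      by (auto simp: in_keys_iff)
    ultimately show ?case
      using Cons ideal_power_P_ideal[of i X "Poly_Mapping.lookup u i" k, where 'k = 'k] u(2)[of i]
        ideal_mult_fiber_ideal[of ?A "Poly_Mapping.keys u \<inter> set ys" X k, where 'k = 'k]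
      by simp
  qed
  from this[of xs] show ?thesis
    using xs u(1) unfolding ideal_prod_def xs_def[symmetric] by (simp add: Int_absorb2)
qed

text \<open>A monomial lies in the expanded ideal iff it meets all fibres over some minimal nonface,
  that is, iff its support projects onto a nonface.\<close>

lemma expansion_face_ideal:
  assumes X: "finite X" and cl: "subset_closed \<Delta>"
  shows "expansion X k (face_ideal X \<Delta> :: ('v, 'k::field) mpoly set)
    = face_ideal (exp_vars X k) {A. fst ` A \<in> \<Delta>}"
proof -
  let ?R = "polys (exp_vars X k) :: ('v \<times> nat, 'k) mpoly set"
  let ?M = "mingens (face_ideal X \<Delta> :: ('v, 'k) mpoly set)"
  let ?G = "\<Union>u\<in>?M. fiber_ideal X k (Poly_Mapping.keys u) :: ('v \<times> nat, 'k) mpoly set"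
  have eq: "expansion X k (face_ideal X \<Delta> :: ('v, 'k) mpoly set) = gen_ideal ?R ?G"
  proof -
    have "ideal_prod ?R (\<lambda>i. ideal_power ?R (P_ideal X k i) (Poly_Mapping.lookup u i)) X
        = fiber_ideal X k (Poly_Mapping.keys u)" if "u \<in> ?M" for u
      by (rule ideal_prod_P_ideal[OF X mingens_face_ideal(1)[OF X that] mingens_face_ideal(3)[OF X that]])
    then show ?thesis unfolding expansion_def Let_def by simp
  qed
  have J: "ideal_of ?R (face_ideal (exp_vars X k) {A. fst ` A \<in> \<Delta>})"
    by (rule ideal_face_ideal) (use cl in \<open>auto simp: subset_closed_def intro: image_mono\<close>)
  have "fiber_ideal X k (Poly_Mapping.keys u) \<subseteq> (face_ideal (exp_vars X k) {A. fst ` A \<in> \<Delta>} :: ('v \<times> nat, 'k) mpoly set)"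
    if "u \<in> ?M" for u
    using mingens_face_ideal(2)[OF X that] cl
    unfolding fiber_ideal_def face_ideal_def subset_closed_def by blast
  then have G: "?G \<subseteq> face_ideal (exp_vars X k) {A. fst ` A \<in> \<Delta>}" by blast
  have "?G \<subseteq> ?R" using ideal_ofD(1)[OF ideal_fiber_ideal] by blast
  then have I: "ideal_of ?R (gen_ideal ?R ?G)" by (rule gen_ideal_ideal)
  have "face_ideal (exp_vars X k) {A. fst ` A \<in> \<Delta>} \<subseteq> gen_ideal ?R ?G"
  proof (rule face_ideal_subset_ideal[OF I])
    fix m :: "'v \<times> nat \<Rightarrow>\<^sub>0 nat" and c :: 'k
    assume m: "Poly_Mapping.keys m \<subseteq> exp_vars X k" "Poly_Mapping.keys m \<notin> {A. fst ` A \<in> \<Delta>}"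
    have "fst ` Poly_Mapping.keys m \<subseteq> X" using m(1) unfolding exp_vars_def by auto
    then obtain u where u: "u \<in> ?M" "Poly_Mapping.keys u \<subseteq> fst ` Poly_Mapping.keys m"
      using mingens_face_ideal_exists[of "fst ` Poly_Mapping.keys m" X \<Delta>, where 'k = 'k] m(2) by auto
    have "Poly_Mapping.single m c \<in> fiber_ideal X k (Poly_Mapping.keys u)"
      using m(1) u(2) unfolding fiber_ideal_def face_ideal_def by auto
    then show "Poly_Mapping.single m c \<in> gen_ideal ?R ?G"
      using u(1) gen_ideal_superset[of ?G] by blast
  qed
  then show ?thesis
    unfolding eq using gen_ideal_least[OF J G] by blast
qed

lemma face_ideal_cong:
  assumes "\<And>A. A \<subseteq> V \<Longrightarrow> A \<in> \<Delta> \<longleftrightarrow> A \<in> \<Delta>'"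
  shows "face_ideal V \<Delta> = face_ideal V \<Delta>'"
  using assms unfolding face_ideal_def polys_def by blast

lemma gen_complex_facets:
  assumes fin: "finite \<Delta>" and cl: "subset_closed \<Delta>"
  shows "gen_complex (facets \<Delta>) = \<Delta>"
proof
  show "gen_complex (facets \<Delta>) \<subseteq> \<Delta>"
    using cl unfolding gen_complex_def facets_def subset_closed_def by blast
  show "\<Delta> \<subseteq> gen_complex (facets \<Delta>)"
  proof
    fix A assume A: "A \<in> \<Delta>"
    obtain F where "F \<in> \<Delta>" "A \<subseteq> F" "\<forall>G\<in>\<Delta>. F \<subseteq> G \<longrightarrow> F = G"
      using finite_has_maximal2[OF fin A] by auto
    then show "A \<in> gen_complex (facets \<Delta>)" unfolding gen_complex_def facets_def by auto
  qed
qed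

lemma facet_subset: "simplicial_complex X \<Delta> \<Longrightarrow> F \<in> facets \<Delta> \<Longrightarrow> F \<subseteq> X"
  by (auto simp: simplicial_complex_def facets_def)

lemma finite_facet: "finite X \<Longrightarrow> simplicial_complex X \<Delta> \<Longrightarrow> F \<in> facets \<Delta> \<Longrightarrow> finite F"
  by (rule finite_subset[OF facet_subset])

text \<open>For \<open>C \<subseteq> Fs ! j\<close>, lying in \<open>\<sigma>\<close> means missing
  its complement in \<open>Fs ! j\<close>; and \<open>\<sigma>\<close>, \<open>\<tau>\<close> cover
  \<open>Fs ! j\<close> iff their complements are disjoint. The first facet gets no blocks, as
  nothing precedes it; by purity \<open>dimc \<Delta> + 1\<close> is the size of every
  facet.\<close>

lemma block_shelling_of_order:
  assumes X: "finite X" and \<Delta>: "simplicial_complex X \<Delta>" and pure: "pure \<Delta>" and k: "k > 0"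
    and Fs: "set Fs = facets \<Delta>"
    and gen: "\<And>j. 1 \<le> j \<Longrightarrow> j < length Fs \<Longrightarrow>
      gen_complex {Fs ! j} \<inter> gen_complex (set (take j Fs)) = gen_complex (A j)"
    and card: "\<And>j \<sigma>. 1 \<le> j \<Longrightarrow> j < length Fs \<Longrightarrow> \<sigma> \<in> A j \<Longrightarrow>
      \<sigma> \<subseteq> Fs ! j \<and> card \<sigma> + k = card (Fs ! j)"
    and cover: "\<And>j \<sigma> \<tau>. 1 \<le> j \<Longrightarrow> j < length Fs \<Longrightarrow> \<sigma> \<in> A j \<Longrightarrow> \<tau> \<in> A j \<Longrightarrow> \<sigma> \<noteq> \<tau> \<Longrightarrow>
      Fs ! j \<subseteq> \<sigma> \<union> \<tau>"
  shows "block_shelling k (nat (dimc \<Delta> + 1)) Fs (\<lambda>j. if j = 0 then {} else (\<lambda>\<sigma>. Fs ! j - \<sigma>) ` A j)"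
    (is "block_shelling k ?d Fs ?Q")
proof -
  define Q where "Q = ?Q"
  have Q: "B \<in> Q j \<longleftrightarrow> 1 \<le> j \<and> (\<exists>\<sigma>\<in>A j. B = Fs ! j - \<sigma>)" for B j
    unfolding Q_def by auto
  have facet: "Fs ! j \<in> facets \<Delta>" if "j < length Fs" for j
    using nth_mem[OF that] Fs by simp
  have finF: "finite (Fs ! j)" if "j < length Fs" for j
    by (rule finite_facet[OF X \<Delta> facet[OF that]])
  have "block_shelling k ?d Fs Q"
  proof (rule block_shelling.intro)
    show "k > 0" by (rule k)
    show "finite (Fs ! j) \<and> card (Fs ! j) = ?d" if j: "j < length Fs" for j
    proof -
      have "int (card (Fs ! j)) - 1 = dimc \<Delta>"
        using facet[OF j] pure unfolding pure_def dimf_def by blast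
      then show ?thesis using finF[OF j] by simp
    qed
    show "B \<subseteq> Fs ! j \<and> card B = k" if j: "j < length Fs" and B: "B \<in> Q j" for j B
    proof -
      obtain \<sigma> where \<sigma>: "1 \<le> j" "\<sigma> \<in> A j" "B = Fs ! j - \<sigma>"
        using B unfolding Q by blast
      note c = card[OF \<sigma>(1) j \<sigma>(2)]
      have "finite \<sigma>" by (rule finite_subset[OF _ finF[OF j]]) (use c in simp)
      then show ?thesis using c \<sigma>(3) by (auto simp: card_Diff_subset)
    qed
    show "B \<inter> B' = {}" if j: "j < length Fs" and B: "B \<in> Q j" "B' \<in> Q j" "B \<noteq> B'" for j B B'
    proof -
      obtain \<sigma> \<tau> where \<sigma>: "1 \<le> j" "\<sigma> \<in> A j" "B = Fs ! j - \<sigma>" "\<tau> \<in> A j" "B' = Fs ! j - \<tau>"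
        using B(1,2) unfolding Q by blast
      then have "Fs ! j \<subseteq> \<sigma> \<union> \<tau>" using cover[OF _ j, of \<sigma> \<tau>] B(3) by metis
      then show ?thesis using \<sigma> by blast
    qed
    show "(\<exists>l<j. C \<subseteq> Fs ! l) \<longleftrightarrow> (\<exists>B\<in>Q j. B \<inter> C = {})"
      if j: "j < length Fs" and C: "C \<subseteq> Fs ! j" for j C
    proof (cases "j = 0")
      case False
      have "(\<exists>l<j. C \<subseteq> Fs ! l) \<longleftrightarrow> C \<in> gen_complex (set (take j Fs))"
        using j by (simp add: mem_gen_complex_set cong: conj_cong)
      also have "\<dots> \<longleftrightarrow> C \<in> gen_complex {Fs ! j} \<inter> gen_complex (set (take j Fs))"
        using C by (auto simp: gen_complex_def)
      also have "\<dots> \<longleftrightarrow> (\<exists>\<sigma>\<in>A j. C \<subseteq> \<sigma>)"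
        using gen[of j] j False by (simp add: gen_complex_def)
      also have "\<dots> \<longleftrightarrow> (\<exists>B\<in>Q j. B \<inter> C = {})"
        using False C unfolding Q_def by auto
      finally show ?thesis .
    qed (simp add: Q_def)
  qed
  then show ?thesis unfolding Q_def .
qed

text \<open>Facets of the intersection have codimension 1, so blocks are single vertices; two
  distinct such faces cover \<open>Fs ! j\<close> by counting.\<close>

lemma block_shelling_if_shellable:
  assumes X: "finite X" and \<Delta>: "simplicial_complex X \<Delta>" and pure: "pure \<Delta>" and sh: "shellable \<Delta>"
  obtains d Fs Q where "block_shelling 1 d Fs Q" "set Fs = facets \<Delta>"
proof -
  obtain Fs where *: "shelling_order \<Delta> Fs \<and> (\<forall>j. 1 \<le> j \<and> j < length Fs \<longrightarrow>
      Defs.pure (gen_complex {Fs ! j} \<inter> gen_complex (set (take j Fs))) \<and>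
      dimc (gen_complex {Fs ! j} \<inter> gen_complex (set (take j Fs))) = dimf (Fs ! j) - 1)"
    using sh[unfolded shellable_def Let_def] by (rule exE)
  note step = conjunct2[OF *]
  have Fs: "set Fs = facets \<Delta>" using * unfolding shelling_order_def by simp
  define \<Gamma> where "\<Gamma> j = gen_complex {Fs ! j} \<inter> gen_complex (set (take j Fs))" for j
  have fin: "finite (Fs ! j)" if "j < length Fs" for j
    by (rule finite_facet[OF X \<Delta>]) (use nth_mem[OF that] Fs in simp)
  have gen: "gen_complex (facets (\<Gamma> j)) = \<Gamma> j" if "j < length Fs" for j
  proof (rule gen_complex_facets)
    show "finite (\<Gamma> j)"
      by (rule finite_subset[of _ "Pow (Fs ! j)"]) (use fin[OF that] in \<open>auto simp: \<Gamma>_def gen_complex_def\<close>)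
    show "subset_closed (\<Gamma> j)" unfolding \<Gamma>_def gen_complex_def subset_closed_def by blast
  qed
  have card: "\<sigma> \<subseteq> Fs ! j \<and> card \<sigma> + 1 = card (Fs ! j)"
    if "1 \<le> j" "j < length Fs" "\<sigma> \<in> facets (\<Gamma> j)" for j \<sigma>
  proof -
    have "dimf \<sigma> = dimf (Fs ! j) - 1"
      using step[rule_format, of j] that unfolding \<Gamma>_def pure_def by auto
    moreover have "\<sigma> \<subseteq> Fs ! j" using that(3) unfolding facets_def \<Gamma>_def gen_complex_def by blast
    ultimately show ?thesis unfolding dimf_def by linarith
  qed
  have cover: "Fs ! j \<subseteq> \<sigma> \<union> \<tau>"
    if j: "1 \<le> j" "j < length Fs" and st: "\<sigma> \<in> facets (\<Gamma> j)" "\<tau> \<in> facets (\<Gamma> j)" "\<sigma> \<noteq> \<tau>" for j \<sigma> \<tau>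
  proof -
    note c = card[OF j st(1)] card[OF j st(2)]
    have f: "finite (\<sigma> \<union> \<tau>)"
      by (rule finite_subset[OF _ fin[OF j(2)]]) (use c in blast)
    have "\<not> \<tau> \<subseteq> \<sigma>" using card_subset_eq[of \<sigma> \<tau>] f c st(3) by auto
    then have "card \<sigma> < card (\<sigma> \<union> \<tau>)" using f by (intro psubset_card_mono) auto
    then have "\<sigma> \<union> \<tau> = Fs ! j"
      using c by (intro card_seteq[OF fin[OF j(2)]]) auto
    then show ?thesis by blast
  qed
  show thesis
  proof (rule that[OF block_shelling_of_order[OF X \<Delta> pure _ Fs, of 1 "\<lambda>j. facets (\<Gamma> j)"] Fs])
    show "gen_complex {Fs ! j} \<inter> gen_complex (set (take j Fs)) = gen_complex (facets (\<Gamma> j))"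
      if "1 \<le> j" "j < length Fs" for j
      using gen[OF that(2)] unfolding \<Gamma>_def by simp
  qed (fact zero_less_one card cover)+
qed

text \<open>The definition fixes the size of the members of a generating set but asks the covering
  condition of facets. Generators of equal size are incomparable, hence facets of the complex they
  generate.\<close>

lemma block_shelling_if_k_shellable:
  assumes X: "finite X" and \<Delta>: "simplicial_complex X \<Delta>" and pure: "pure \<Delta>" and sh: "k_shellable k \<Delta>"
  obtains d Fs Q where "block_shelling k d Fs Q" "set Fs = facets \<Delta>"
proof -
  define \<Gamma> where "\<Gamma> Fs j = gen_complex {Fs ! j} \<inter> gen_complex (set (take j Fs))" for Fs :: "'a set list" and j
  have k: "k > 0" using sh unfolding k_shellable_def by simp
  obtain Fs where *: "shelling_order \<Delta> Fs \<and> (\<forall>j. 1 \<le> j \<and> j < length Fs \<longrightarrow>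
      (\<exists>A. A \<noteq> {} \<and> A \<subseteq> gen_complex {Fs ! j} \<and> (\<forall>G\<in>A. dimf G = int (card (Fs ! j)) - int k - 1)
        \<and> \<Gamma> Fs j = gen_complex A) \<and>
      (card (facets (\<Gamma> Fs j)) > 1 \<longrightarrow> (\<forall>\<sigma>\<in>facets (\<Gamma> Fs j). \<forall>\<tau>\<in>facets (\<Gamma> Fs j). \<sigma> \<noteq> \<tau> \<longrightarrow> Fs ! j \<subseteq> \<sigma> \<union> \<tau>)))"
    unfolding \<Gamma>_def using sh[unfolded k_shellable_def Let_def, THEN conjunct2, THEN conjunct2] by (rule exE)
  note step = conjunct2[OF *]
  have Fs: "set Fs = facets \<Delta>" using * unfolding shelling_order_def by simp
  define P where "P j A \<longleftrightarrow> A \<subseteq> gen_complex {Fs ! j} \<and>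
      (\<forall>G\<in>A. dimf G = int (card (Fs ! j)) - int k - 1) \<and> \<Gamma> Fs j = gen_complex A" for j A
  have exP: "\<exists>A. P j A" if "1 \<le> j \<and> j < length Fs" for j
    using step[rule_format, OF that, THEN conjunct1] unfolding P_def by (elim exE conjE, intro exI conjI)
  define A where "A j = (SOME A. P j A)" for j
  have PA: "P j (A j)" if "1 \<le> j \<and> j < length Fs" for j
    unfolding A_def by (rule someI_ex[OF exP[OF that]])
  have A: "A j \<subseteq> gen_complex {Fs ! j}" "\<forall>G\<in>A j. dimf G = int (card (Fs ! j)) - int k - 1"
    "\<Gamma> Fs j = gen_complex (A j)" if "1 \<le> j" "j < length Fs" for j
    using PA[of j] that unfolding P_def by simp_all
  have fin: "finite (Fs ! j)" if "j < length Fs" for j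
    by (rule finite_facet[OF X \<Delta>]) (use nth_mem[OF that] Fs in simp)
  have card: "\<sigma> \<subseteq> Fs ! j \<and> card \<sigma> + k = card (Fs ! j)"
    if "1 \<le> j" "j < length Fs" "\<sigma> \<in> A j" for j \<sigma>
  proof -
    have "int (card \<sigma>) - 1 = int (card (Fs ! j)) - int k - 1"
      using A(2)[OF that(1,2)] that(3) unfolding dimf_def by blast
    moreover have "\<sigma> \<subseteq> Fs ! j" using A(1)[OF that(1,2)] that(3) by (auto simp: gen_complex_def)
    ultimately show ?thesis by simp
  qed
  have facet: "\<sigma> \<in> facets (\<Gamma> Fs j)" if j: "1 \<le> j" "j < length Fs" and \<sigma>: "\<sigma> \<in> A j" for j \<sigma>
    unfolding facets_def
  proof (intro CollectI conjI ballI impI)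
    show "\<sigma> \<in> \<Gamma> Fs j" using A(3)[OF j] \<sigma> by (auto simp: gen_complex_def)
    fix G assume G: "G \<in> \<Gamma> Fs j" "\<sigma> \<subseteq> G"
    then obtain \<tau> where \<tau>: "\<tau> \<in> A j" "G \<subseteq> \<tau>" using A(3)[OF j] by (auto simp: gen_complex_def)
    have "\<sigma> = \<tau>"
      using card[OF j \<sigma>] card[OF j \<tau>(1)] G(2) \<tau>(2) fin[OF j(2)]
      by (intro card_subset_eq) (auto intro: finite_subset)
    then show "G = \<sigma>" using G \<tau> by blast
  qed
  have cover: "Fs ! j \<subseteq> \<sigma> \<union> \<tau>"
    if j: "1 \<le> j" "j < length Fs" and st: "\<sigma> \<in> A j" "\<tau> \<in> A j" "\<sigma> \<noteq> \<tau>" for j \<sigma> \<tau>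
  proof -
    \<comment> \<open>\<open>card\<close> of an infinite set is 0, so finiteness is needed to see
      that there is more than one facet.\<close>
    have "finite (facets (\<Gamma> Fs j))"
      by (rule finite_subset[of _ "Pow (Fs ! j)"])
        (use fin[OF j(2)] in \<open>auto simp: \<Gamma>_def gen_complex_def facets_def\<close>)
    then have "card {\<sigma>, \<tau>} \<le> card (facets (\<Gamma> Fs j))"
      using facet[OF j st(1)] facet[OF j st(2)] by (intro card_mono) auto
    then have "card (facets (\<Gamma> Fs j)) > 1" using st(3) by simp
    then show ?thesis using step j facet[OF j st(1)] facet[OF j st(2)] st(3) by blast
  qed
  show thesis
  proof (rule that[OF block_shelling_of_order[OF X \<Delta> pure k Fs, of A] Fs])
    show "gen_complex {Fs ! j} \<inter> gen_complex (set (take j Fs)) = gen_complex (A j)"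
      if "1 \<le> j" "j < length Fs" for j
      using A(3)[OF that] unfolding \<Gamma>_def .
  qed (fact card cover)+
qed

text \<open>A subset of \<open>Fs ! j \<times> N\<close> lies in an earlier product, or meets
  \<open>B \<times> N\<close>, iff its projection lies in the earlier facet, or meets
  \<open>B\<close>.\<close>

lemma block_shelling_Times:
  assumes "block_shelling k d Fs Q" "finite N" "N \<noteq> {}"
  shows "block_shelling (k * card N) (d * card N) (map (\<lambda>F. F \<times> N) Fs) (\<lambda>j. (\<lambda>B. B \<times> N) ` Q j)"
proof -
  interpret block_shelling k d Fs Q by (rule assms(1))
  show ?thesis
  proof
    show "k * card N > 0" using k_pos assms(2,3) by (simp add: card_gt_0_iff)
    fix j assume "j < length (map (\<lambda>F. F \<times> N) Fs)"
    then have j: "j < length Fs" "map (\<lambda>F. F \<times> N) Fs ! j = Fs ! j \<times> N" by simp_all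
    show "finite (map (\<lambda>F. F \<times> N) Fs ! j) \<and> card (map (\<lambda>F. F \<times> N) Fs ! j) = d * card N"
      using facet[OF j(1)] assms(2) by (simp add: j(2) card_cartesian_product)
    show "B \<subseteq> map (\<lambda>F. F \<times> N) Fs ! j \<and> card B = k * card N" if "B \<in> (\<lambda>B. B \<times> N) ` Q j" for B
      using that block[OF j(1)] by (auto simp: j(2) card_cartesian_product)
    show "B \<inter> B' = {}" if "B \<in> (\<lambda>B. B \<times> N) ` Q j" "B' \<in> (\<lambda>B. B \<times> N) ` Q j" "B \<noteq> B'" for B B'
      using that disjoint[OF j(1)] by blast
    fix A assume "A \<subseteq> map (\<lambda>F. F \<times> N) Fs ! j"
    then have A: "A \<subseteq> Fs ! j \<times> N" by (simp add: j(2))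
    then have "fst ` A \<subseteq> Fs ! j" by auto
    then have "(\<exists>l<j. fst ` A \<subseteq> Fs ! l) \<longleftrightarrow> (\<exists>B\<in>Q j. B \<inter> fst ` A = {})"
      by (rule shell[OF j(1)])
    moreover have "A \<subseteq> map (\<lambda>F. F \<times> N) Fs ! l \<longleftrightarrow> fst ` A \<subseteq> Fs ! l" if "l < j" for l
      using that j(1) A by auto
    moreover have "B \<times> N \<inter> A = {} \<longleftrightarrow> B \<inter> fst ` A = {}" for B
      using A by force
    ultimately show "(\<exists>l<j. A \<subseteq> map (\<lambda>F. F \<times> N) Fs ! l) \<longleftrightarrow> (\<exists>B\<in>(\<lambda>B. B \<times> N) ` Q j. B \<inter> A = {})"
      by auto
  qed
qed

theorem theorem3p2:
  fixes X :: "'v set" and \<Delta> :: "'v set set" and k :: nat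
  assumes "finite X" and "simplicial_complex X \<Delta>"
  shows "(pure \<Delta> \<and> shellable \<Delta> \<and> k > 0 \<longrightarrow>
            stanley_conjecture_holds (exp_vars X k)
              (expansion X k (SR_ideal X \<Delta> :: ('v, 'k::field) mpoly set)))
       \<and> (pure \<Delta> \<and> k_shellable k \<Delta> \<longrightarrow>
            stanley_conjecture_holds X (SR_ideal X \<Delta> :: ('v, 'k::field) mpoly set))"
proof (intro conjI impI; elim conjE)
  have cl: "subset_closed \<Delta>" by (rule subset_closed_simplicial_complex[OF assms(2)])
  have "finite \<Delta>"
    using assms finite_subset[of \<Delta> "Pow X"] unfolding simplicial_complex_def by blast
  then have gen: "gen_complex (facets \<Delta>) = \<Delta>" by (rule gen_complex_facets[OF _ cl])
  have sub: "\<Union>(facets \<Delta>) \<subseteq> X"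
    using facet_subset[OF assms(2)] by blast
  have ne: "facets \<Delta> \<noteq> {}"
    using gen assms(2) unfolding gen_complex_def simplicial_complex_def by auto
  note SR = SR_ideal_eq_face_ideal[OF assms, where 'k = 'k]
  {
    assume "pure \<Delta>" "k_shellable k \<Delta>"
    then obtain d Fs Q where "block_shelling k d Fs Q" and Fs: "set Fs = facets \<Delta>"
      by (rule block_shelling_if_k_shellable[OF assms])
    then interpret block_shelling k d Fs Q by simp
    show "stanley_conjecture_holds X (SR_ideal X \<Delta> :: ('v, 'k) mpoly set)"
    proof -
      have "Fs \<noteq> []" using ne Fs by auto
      then show ?thesis
        unfolding SR using stanley_conjecture[OF assms(1), where 'k = 'k] Fs sub gen by simp
    qed
  }
  assume "pure \<Delta>" "shellable \<Delta>" and k: "k > 0"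
  then obtain d Fs Q where sh: "block_shelling 1 d Fs Q" and Fs: "set Fs = facets \<Delta>"
    using block_shelling_if_shellable[OF assms] by blast
  let ?Fs = "map (\<lambda>F. F \<times> {1..k}) Fs"
  interpret block_shelling "1 * card {1..k}" "d * card {1..k}" ?Fs "\<lambda>j. (\<lambda>B. B \<times> {1..k}) ` Q j"
    by (rule block_shelling_Times[OF sh]) (use k in auto)
  \<comment> \<open>The two families may differ on sets leaving \<open>exp_vars X k\<close>, which
    \<open>face_ideal\<close> does not see.\<close>
  have "A \<in> {A. fst ` A \<in> \<Delta>} \<longleftrightarrow> A \<in> gen_complex (set ?Fs)" if "A \<subseteq> exp_vars X k" for A
  proof -
    have "fst ` A \<in> \<Delta> \<longleftrightarrow> (\<exists>F\<in>facets \<Delta>. fst ` A \<subseteq> F)"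
      using gen unfolding gen_complex_def by blast
    also have "\<dots> \<longleftrightarrow> (\<exists>F\<in>facets \<Delta>. A \<subseteq> F \<times> {1..k})"
      using that unfolding exp_vars_def by (intro bex_cong) auto
    finally show ?thesis by (simp add: gen_complex_def Fs)
  qed
  then have "(face_ideal (exp_vars X k) {A. fst ` A \<in> \<Delta>} :: ('v \<times> nat, 'k) mpoly set)
      = face_ideal (exp_vars X k) (gen_complex (set ?Fs))"
    by (rule face_ideal_cong)
  moreover have "\<Union>(set ?Fs) \<subseteq> exp_vars X k" using sub Fs unfolding exp_vars_def by auto
  moreover have "finite (exp_vars X k)" using assms(1) unfolding exp_vars_def by simp
  moreover have "?Fs \<noteq> []" using ne Fs by auto
  ultimately show "stanley_conjecture_holds (exp_vars X k)
      (expansion X k (SR_ideal X \<Delta> :: ('v, 'k) mpoly set))"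
    unfolding SR expansion_face_ideal[OF assms(1) cl] using stanley_conjecture by auto
qed

end
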